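(* Let $\nu,\mu\in\mathbb Z$, $N\in\mathbb Z\setminus\{0\}$, and let the theta functions $\theta_k,\theta_1'$ be evaluated at $\big(\frac{\nu}{2N}\tau+\frac{\mu}{2N}\big|\tau\big)$. Let $x=\vartheta_4^4/\vartheta_3^4$, and let $y=y(\tau)$ be the corresponding algebraic solution of the sixth Painlevé equation of Picard's type $$y=-\frac{\vartheta_4^2}{\vartheta_3^2}\frac{\theta_2^2}{\theta_1^2}$$ or of Hitchin's type $$y=\frac{\vartheta_4^2}{\vartheta_3^2}\,\frac{\theta_2}{\theta_1^2}\left\{\frac{\pi\vartheta_2^2\,\theta_3\theta_4}{\theta_1'+\pi i\frac{\nu}{N}\theta_1}-\theta_2\right\}.$$ Then the differentials $dy=\dot y\,d\tau$, as differentials on the corresponding curves $F(x,y)=0$, are given by $$\dot y=\pi i\,\vartheta_3^6\,\theta_1^2\,\frac{y(y-1)(y-x)}{\vartheta_3^2\theta_1^2\,y+\vartheta_4^2\theta_2^2}+\frac{\pi}{2i}\vartheta_3^4(y-x)^2+\frac{\pi}{2i}\vartheta_2^4\,x\qquad(\text{Hitchin's curves}),$$ $$\dot y=i\,\vartheta_2^2\Big(\theta_1'+\pi i\frac{\nu}{N}\theta_1\Big)\frac{\theta_3\theta_4}{\theta_2\theta_1^2}\,y+\pi i\,\vartheta_3^4\,y(y-1)\qquad(\text{Picard's curves}).$$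
   Context: Dots denote derivatives in $\tau\in\mathbb H^+$ (upper half-plane). Theta functions: for integers $a,b$, $\theta\big[{a\atop b}\big](z|\tau)=\sum_{k\in\mathbb Z}\exp\big(\pi i(k+\tfrac a2)^2\tau+2\pi i(k+\tfrac a2)(z+\tfrac b2)\big)$, and $\theta_1=-\theta\big[{1\atop1}\big]$, $\theta_2=\theta\big[{1\atop0}\big]$, $\theta_3=\theta\big[{0\atop0}\big]$, $\theta_4=\theta\big[{0\atop1}\big]$; $\vartheta_k=\vartheta_k(\tau)=\theta_k(0|\tau)$; $\theta_1'(z|\tau)=\partial_z\theta_1(z|\tau)$. Picard's and Hitchin's types refer to the sixth Painlevé equation $$y_{xx}=\tfrac12\Big(\tfrac1y+\tfrac1{y-1}+\tfrac1{y-x}\Big)y_x^2-\Big(\tfrac1x+\tfrac1{x-1}+\tfrac1{y-x}\Big)y_x+\frac{y(y-1)(y-x)}{x^2(x-1)^2}\Big\{\alpha-\beta\frac{x}{y^2}+\gamma\frac{x-1}{(y-1)^2}-\big(\delta-\tfrac12\big)\frac{x(x-1)}{(y-x)^2}\Big\}$$ with $\alpha=\beta=\gamma=\delta=0$ and $\alpha=\beta=\gamma=\delta=\frac18$ respectively; $F(x,y)=0$ is the algebraic relation between $x(\tau)$ and $y(\tau)$. *)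

theory Defs
  imports "HOL-Analysis.Analysis"
begin

text \<open>
  The series below converges absolutely when \<open>Im \<tau> > 0\<close>; for other \<open>\<tau>\<close> the value of
  the infinite sum carries no meaning and is never used.
\<close>

definition theta_char :: "int \<Rightarrow> int \<Rightarrow> complex \<Rightarrow> complex \<Rightarrow> complex" where
  "theta_char a b z \<tau> =
     (\<Sum>\<^sub>\<infinity>k\<in>(UNIV :: int set).
        exp (of_real pi * \<i> * (of_int k + of_int a / 2)\<^sup>2 * \<tau>
             + 2 * of_real pi * \<i> * (of_int k + of_int a / 2) * (z + of_int b / 2)))"

definition theta1 :: "complex \<Rightarrow> complex \<Rightarrow> complex" where
  "theta1 z \<tau> = - theta_char 1 1 z \<tau>"

definition theta2 :: "complex \<Rightarrow> complex \<Rightarrow> complex" where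
  "theta2 z \<tau> = theta_char 1 0 z \<tau>"

definition theta3 :: "complex \<Rightarrow> complex \<Rightarrow> complex" where
  "theta3 z \<tau> = theta_char 0 0 z \<tau>"

definition theta4 :: "complex \<Rightarrow> complex \<Rightarrow> complex" where
  "theta4 z \<tau> = theta_char 0 1 z \<tau>"

text \<open>The prime is the derivative in the first argument, with \<open>\<tau>\<close> held fixed.\<close>

definition theta1_prime :: "complex \<Rightarrow> complex \<Rightarrow> complex" where
  "theta1_prime z \<tau> = deriv (\<lambda>w. theta1 w \<tau>) z"

definition vartheta2 :: "complex \<Rightarrow> complex" where
  "vartheta2 \<tau> = theta2 0 \<tau>"

definition vartheta3 :: "complex \<Rightarrow> complex" where
  "vartheta3 \<tau> = theta3 0 \<tau>"

definition vartheta4 :: "complex \<Rightarrow> complex" where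
  "vartheta4 \<tau> = theta4 0 \<tau>"

definition torsion_point :: "int \<Rightarrow> int \<Rightarrow> int \<Rightarrow> complex \<Rightarrow> complex" where
  "torsion_point \<nu> \<mu> N \<tau> = of_int \<nu> / (2 * of_int N) * \<tau> + of_int \<mu> / (2 * of_int N)"

text \<open>
  The combination \<open>\<theta>\<^sub>1' + \<pi> i (\<nu>/N) \<theta>\<^sub>1\<close> at the torsion point. The zeros of this function of
  \<open>\<tau>\<close> are poles of the Hitchin solution; it vanishes identically at the half-periods.
\<close>

definition theta1_shifted :: "int \<Rightarrow> int \<Rightarrow> int \<Rightarrow> complex \<Rightarrow> complex" where
  "theta1_shifted \<nu> \<mu> N \<tau> =
     theta1_prime (torsion_point \<nu> \<mu> N \<tau>) \<tau>
     + of_real pi * \<i> * (of_int \<nu> / of_int N) * theta1 (torsion_point \<nu> \<mu> N \<tau>) \<tau>"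

definition painleve_x :: "complex \<Rightarrow> complex" where
  "painleve_x \<tau> = vartheta4 \<tau> ^ 4 / vartheta3 \<tau> ^ 4"

text \<open>
  Both solutions are parametrised by \<open>\<tau>\<close>: the torsion point, at which the theta functions are
  taken, moves together with the modulus.
\<close>

definition picard_y :: "int \<Rightarrow> int \<Rightarrow> int \<Rightarrow> complex \<Rightarrow> complex" where
  "picard_y \<nu> \<mu> N \<tau> =
     (let z = torsion_point \<nu> \<mu> N \<tau>
      in - ((vartheta4 \<tau>)\<^sup>2 / (vartheta3 \<tau>)\<^sup>2) * ((theta2 z \<tau>)\<^sup>2 / (theta1 z \<tau>)\<^sup>2))"

definition hitchin_y :: "int \<Rightarrow> int \<Rightarrow> int \<Rightarrow> complex \<Rightarrow> complex" where
  "hitchin_y \<nu> \<mu> N \<tau> =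
     (let z = torsion_point \<nu> \<mu> N \<tau>
      in (vartheta4 \<tau>)\<^sup>2 / (vartheta3 \<tau>)\<^sup>2 * (theta2 z \<tau> / (theta1 z \<tau>)\<^sup>2)
         * (of_real pi * (vartheta2 \<tau>)\<^sup>2 * theta3 z \<tau> * theta4 z \<tau> / theta1_shifted \<nu> \<mu> N \<tau>
            - theta2 z \<tau>))"

end

theory Submission
  imports Defs "HOL-Library.Nat_Bijection"
begin

text \<open>
  Along a path \<open>z = \<alpha> \<tau> + w\<close> the heat equation turns the total \<open>\<tau>\<close>-derivative of a theta
  function into \<open>z\<close>-derivatives: \<open>4 \<pi> i D f = f'' + 4 \<pi> i \<alpha> f'\<close>. Put \<open>r = \<theta>\<^sub>2 / \<theta>\<^sub>1\<close>,
  \<open>p = \<theta>\<^sub>1' / \<theta>\<^sub>1 + 2 \<pi> i \<alpha>\<close>, \<open>s = r' / p\<close>, \<open>A = \<vartheta>\<^sub>3\<^sup>2\<close> and \<open>B = \<vartheta>\<^sub>4\<^sup>2\<close>. Then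

  \<open>4 \<pi> i D r = r'' + 2 r' p\<close>  and  \<open>4 \<pi> i D s = s r''' / r' + 2 r'' - s\<^sup>2 p'' / r'\<close>,

  while \<open>y = - (B / A) r\<^sup>2\<close> for Picard and, because \<open>r' = - \<pi> \<vartheta>\<^sub>2\<^sup>2 \<theta>\<^sub>3 \<theta>\<^sub>4 / \<theta>\<^sub>1\<^sup>2\<close>,
  \<open>y = - (B / A) r (s + r)\<close> for Hitchin. So everything follows from the elliptic function
  identities

  \<open>r'\<^sup>2 = \<pi>\<^sup>2 (A r\<^sup>2 + B) (B r\<^sup>2 + A)\<close>,  \<open>r'' = \<pi>\<^sup>2 r (2 A B r\<^sup>2 + A\<^sup>2 + B\<^sup>2)\<close>,  \<open>p' = - \<pi>\<^sup>2 A B r\<^sup>2 + C\<close>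

  with \<open>C\<close> independent of \<open>z\<close> (it cancels), together with
  \<open>d/d\<tau> log (\<vartheta>\<^sub>4 / \<vartheta>\<^sub>3) = - (\<pi> i / 4) \<vartheta>\<^sub>2\<^sup>4\<close>; what remains is rational algebra in \<open>A\<close>, \<open>B\<close>,
  \<open>r\<close> and \<open>s\<close>.

  A single tool produces the theta identities: \<open>theta_deriv_0_mult\<close>, which multiplies two
  series and splits the double sum by the parity of the sum of the indices, giving theta functions
  of modulus \<open>2 \<tau>\<close>. Besides the algebraic relations it yields duplication formulas, and these
  replace the theory of infinite products and contour integrals: a quantity that is invariant under
  \<open>\<tau> \<mapsto> 2 \<tau>\<close> equals its limit as \<open>Im \<tau>\<close> tends to infinity, where only the leading terms of the
  series survive. This gives the nonvanishing of the theta constants, Jacobi's derivative formula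
  \<open>\<theta>\<^sub>1'(0) = \<pi> \<vartheta>\<^sub>2 \<vartheta>\<^sub>3 \<vartheta>\<^sub>4\<close>, and the fact that \<open>\<theta>\<^sub>1\<close> vanishes at lattice points only.

  The location of the zeros matters because the right-hand side of Hitchin's equation contains a
  quotient whose denominator is \<open>- B r s \<theta>\<^sub>1\<^sup>2\<close>. It vanishes when one of \<open>\<theta>\<^sub>2\<close>, \<open>\<theta>\<^sub>3\<close>, \<open>\<theta>\<^sub>4\<close>
  does, that is, at half-periods; but there \<open>\<theta>\<^sub>1' + 2 \<pi> i \<alpha> \<theta>\<^sub>1\<close> vanishes as well, by the
  symmetry of \<open>\<theta>\<^sub>1\<close> about a half-period.
\<close>

section \<open>Theta series and their derivatives\<close>

text \<open>
  The factor in front of the exponential is the one that \<open>n\<close> differentiations in \<open>z\<close> produce, so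
  that \<open>theta_deriv n\<close> is the \<open>n\<close>-th derivative of the theta series in \<open>z\<close>.
\<close>

definition theta_term :: "nat \<Rightarrow> int \<Rightarrow> int \<Rightarrow> complex \<Rightarrow> complex \<Rightarrow> int \<Rightarrow> complex" where
  "theta_term n a b z \<tau> k =
     (2 * of_real pi * \<i> * (of_int k + of_int a / 2)) ^ n
     * exp (of_real pi * \<i> * (of_int k + of_int a / 2)\<^sup>2 * \<tau>
            + 2 * of_real pi * \<i> * (of_int k + of_int a / 2) * (z + of_int b / 2))"

definition theta_deriv :: "nat \<Rightarrow> int \<Rightarrow> int \<Rightarrow> complex \<Rightarrow> complex \<Rightarrow> complex" where
  "theta_deriv n a b z \<tau> = (\<Sum>\<^sub>\<infinity>k\<in>UNIV. theta_term n a b z \<tau> k)"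

lemma theta_char_eq_theta_deriv: "theta_char a b z \<tau> = theta_deriv 0 a b z \<tau>"
  by (simp add: theta_char_def theta_deriv_def theta_term_def)

lemma norm_theta_term:
  "norm (theta_term n a b z \<tau> k) =
     (2 * pi * \<bar>of_int k + of_int a / 2\<bar>) ^ n
     * exp (- pi * (of_int k + of_int a / 2)\<^sup>2 * Im \<tau> - 2 * pi * (of_int k + of_int a / 2) * Im z)"
proof -
  define u :: real where "u = of_int k + of_int a / 2"
  have u: "(of_int k + of_int a / 2 :: complex) = of_real u"
    by (simp add: u_def)
  have "norm (2 * of_real pi * \<i> * of_real u :: complex) = 2 * pi * \<bar>u\<bar>"
    by (simp add: norm_mult)
  moreover have "Re (of_real pi * \<i> * (of_real u)\<^sup>2 * \<tau> + 2 * of_real pi * \<i> * of_real u * (z + of_int b / 2))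
     = - pi * u\<^sup>2 * Im \<tau> - 2 * pi * u * Im z"
    by (simp add: power2_eq_square algebra_simps)
  ultimately show ?thesis
    unfolding theta_term_def u norm_mult norm_power norm_exp_eq_Re u_def[symmetric] by metis
qed

lemma summable_exp_neg_abs_int: "(\<lambda>k::int. exp (- \<bar>real_of_int k\<bar>)) summable_on UNIV"
proof -
  have geo: "(\<lambda>n::nat. exp (- real n)) summable_on UNIV"
    using summable_geometric[of "exp (-1::real)"]
    by (simp add: summable_on_UNIV_nonneg_real_iff exp_of_nat_mult[symmetric] algebra_simps)
  have "(\<lambda>k::int. exp (- \<bar>real_of_int k\<bar>)) summable_on range int"
    by (subst summable_on_reindex) (use geo in \<open>auto simp: o_def\<close>)
  moreover have "(\<lambda>k::int. exp (- \<bar>real_of_int k\<bar>)) summable_on range (\<lambda>n. - int n)"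
    by (subst summable_on_reindex) (use geo in \<open>auto simp: o_def inj_def\<close>)
  ultimately have "(\<lambda>k::int. exp (- \<bar>real_of_int k\<bar>)) summable_on (range int \<union> range (\<lambda>n. - int n))"
    by (rule summable_on_union)
  moreover have "range int \<union> range (\<lambda>n. - int n) = UNIV"
    by (auto, metis int_cases2 rangeI)
  ultimately show ?thesis by simp
qed

text \<open>
  With \<open>u = \<bar>k + a / 2\<bar>\<close>, the polynomial factor is absorbed by \<open>(2 \<pi> u)\<^sup>n \<le> n! exp (2 \<pi> u)\<close>, and
  completing the square in \<open>- \<pi> t u\<^sup>2 + c u\<close> leaves \<open>exp (- u)\<close> to spare. The bound is uniform on
  regions \<open>Im \<tau> \<ge> t\<close>, \<open>\<bar>Im z\<bar> \<le> R\<close>, as termwise differentiation requires.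
\<close>

lemma theta_term_bound:
  assumes "t > 0"
  shows "\<exists>C. \<forall>k z \<tau>. t \<le> Im \<tau> \<and> \<bar>Im z\<bar> \<le> R \<longrightarrow>
           norm (theta_term n a b z \<tau> k) \<le> C * exp (- \<bar>of_int k\<bar>)"
proof -
  define c where "c = 2 * pi * R + 2 * pi + 1"
  define C where "C = fact n * exp (c\<^sup>2 / (4 * pi * t)) * exp (\<bar>of_int a / 2\<bar> :: real)"
  have "norm (theta_term n a b z \<tau> k) \<le> C * exp (- \<bar>of_int k\<bar>)"
    if \<tau>: "Im \<tau> \<ge> t" and z: "\<bar>Im z\<bar> \<le> R" for k z \<tau>
  proof -
    define v :: real where "v = of_int k + of_int a / 2"
    define u where "u = \<bar>v\<bar>"
    have u: "u \<ge> 0" and uk: "u \<ge> \<bar>of_int k\<bar> - \<bar>of_int a / 2\<bar>"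
      by (auto simp: u_def v_def)
    have v2: "v\<^sup>2 = u\<^sup>2" by (simp add: u_def)
    have pw: "(2 * pi * u) ^ n \<le> fact n * exp (2 * pi * u)"
    proof -
      have "inverse (fact n) *\<^sub>R (2 * pi * u) ^ n \<le> (\<Sum>m. inverse (fact m) *\<^sub>R (2 * pi * u) ^ m)"
        using sum_le_suminf[OF summable_exp_generic[of "2 * pi * u"], of "{n}"] u by simp
      thus ?thesis by (simp add: exp_def field_simps)
    qed
    have "- (v * Im z) \<le> u * R"
    proof -
      have "- (v * Im z) \<le> \<bar>v\<bar> * \<bar>Im z\<bar>" by (metis abs_ge_minus_self abs_mult)
      also have "\<dots> \<le> u * R" using z by (simp add: u_def mult_left_mono)
      finally show ?thesis .
    qed
    hence "2 * pi * (- (v * Im z)) \<le> 2 * pi * (u * R)" by (intro mult_left_mono) auto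
    moreover have "pi * u\<^sup>2 * t \<le> pi * u\<^sup>2 * Im \<tau>" using \<tau> by (intro mult_left_mono) auto
    ultimately have "2 * pi * (- (v * Im z)) - pi * u\<^sup>2 * Im \<tau> \<le> 2 * pi * (u * R) - pi * u\<^sup>2 * t"
      by linarith
    hence "- pi * v\<^sup>2 * Im \<tau> - 2 * pi * v * Im z \<le> - pi * u\<^sup>2 * t + 2 * pi * R * u"
      unfolding v2 by (simp only: minus_mult_left[symmetric] minus_mult_right[symmetric] mult_ac diff_conv_add_uminus add_ac)
    moreover have "- pi * u\<^sup>2 * t + 2 * pi * R * u + 2 * pi * u \<le> c\<^sup>2 / (4 * pi * t) - u"
    proof -
      have "0 \<le> (2 * pi * t * u - c)\<^sup>2 / (4 * pi * t)" using assms by simp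
      also have "\<dots> = pi * t * u\<^sup>2 - c * u + c\<^sup>2 / (4 * pi * t)"
        using assms by (simp add: power2_eq_square field_simps)
      finally show ?thesis by (simp add: c_def algebra_simps)
    qed
    ultimately have ex: "(- pi * v\<^sup>2 * Im \<tau> - 2 * pi * v * Im z) + 2 * pi * u
                  \<le> c\<^sup>2 / (4 * pi * t) + \<bar>of_int a / 2\<bar> - \<bar>of_int k\<bar>"
      using uk by linarith
    have "norm (theta_term n a b z \<tau> k) = (2 * pi * u) ^ n * exp (- pi * v\<^sup>2 * Im \<tau> - 2 * pi * v * Im z)"
      by (simp add: norm_theta_term u_def v_def)
    also have "\<dots> \<le> fact n * exp (2 * pi * u) * exp (- pi * v\<^sup>2 * Im \<tau> - 2 * pi * v * Im z)"
      by (intro mult_right_mono pw) auto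
    also have "\<dots> = fact n * exp ((- pi * v\<^sup>2 * Im \<tau> - 2 * pi * v * Im z) + 2 * pi * u)"
      unfolding exp_add by simp
    also have "\<dots> \<le> fact n * exp (c\<^sup>2 / (4 * pi * t) + \<bar>of_int a / 2\<bar> - \<bar>of_int k\<bar>)"
      by (intro mult_left_mono) (use ex in auto)
    also have "\<dots> = C * exp (- \<bar>of_int k\<bar>)"
      by (simp add: C_def mult_exp_exp mult.assoc)
    finally show ?thesis .
  qed
  thus ?thesis by blast
qed

lemma theta_term_abs_summable:
  assumes "Im \<tau> > 0"
  shows "(\<lambda>k. norm (theta_term n a b z \<tau> k)) summable_on UNIV"
proof -
  obtain C where C: "\<forall>k z' \<tau>'. Im \<tau> \<le> Im \<tau>' \<and> \<bar>Im z'\<bar> \<le> \<bar>Im z\<bar> \<longrightarrow>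
      norm (theta_term n a b z' \<tau>' k) \<le> C * exp (- \<bar>of_int k\<bar>)"
    using theta_term_bound[OF assms, of "\<bar>Im z\<bar>" n a b] by (elim exE)
  have "norm (theta_term n a b z \<tau> k) \<le> C * exp (- \<bar>of_int k\<bar>)" for k
    using C by auto
  thus ?thesis
    by (intro summable_on_comparison_test[OF summable_on_cmult_right[OF summable_exp_neg_abs_int, of C]])
       auto
qed

lemma theta_term_summable:
  assumes "Im \<tau> > 0"
  shows "theta_term n a b z \<tau> summable_on A"
  by (rule summable_on_subset[OF abs_summable_summable[OF theta_term_abs_summable[OF assms]]]) auto

lemma theta_deriv_has_sum:
  assumes "Im \<tau> > 0"
  shows "(theta_term n a b z \<tau> has_sum theta_deriv n a b z \<tau>) UNIV"
  unfolding theta_deriv_def by (rule has_sum_infsum[OF theta_term_summable[OF assms]])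

lemma theta_deriv_sums:
  assumes "Im \<tau> > 0"
  shows "(\<lambda>m. theta_term n a b z \<tau> (int_decode m)) sums theta_deriv n a b z \<tau>"
  using theta_deriv_has_sum[OF assms, of n a b z]
  by (intro has_sum_imp_sums) (simp add: has_sum_reindex_bij_betw[OF bij_int_decode])

lemma theta_term_has_derivative_line:
  "((\<lambda>t. theta_term n a b (\<alpha> * t + w) (\<beta> * t + \<sigma>) k) has_field_derivative
     (\<alpha> * theta_term (n + 1) a b (\<alpha> * t + w) (\<beta> * t + \<sigma>) k
      + \<beta> / (4 * of_real pi * \<i>) * theta_term (n + 2) a b (\<alpha> * t + w) (\<beta> * t + \<sigma>) k)) (at t within S)"
proof -
  define u where "u = (of_int k + of_int a / 2 :: complex)"
  define E where "E = (\<lambda>t. exp (of_real pi * \<i> * u\<^sup>2 * (\<beta> * t + \<sigma>)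
     + 2 * of_real pi * \<i> * u * (\<alpha> * t + w + of_int b / 2)))"
  have "((\<lambda>t. (2 * of_real pi * \<i> * u) ^ n * E t) has_field_derivative
     (2 * of_real pi * \<i> * u) ^ n * (E t * (of_real pi * \<i> * u\<^sup>2 * \<beta> + 2 * of_real pi * \<i> * u * \<alpha>)))
     (at t within S)"
    unfolding E_def by (auto intro!: derivative_eq_intros)
  moreover have "(2 * of_real pi * \<i> * u) ^ n * (E t * (of_real pi * \<i> * u\<^sup>2 * \<beta> + 2 * of_real pi * \<i> * u * \<alpha>))
    = \<alpha> * ((2 * of_real pi * \<i> * u) ^ (n + 1) * E t)
      + \<beta> / (4 * of_real pi * \<i>) * ((2 * of_real pi * \<i> * u) ^ (n + 2) * E t)"
  proof -
    define P where "P = (2 * of_real pi * \<i> * u) ^ n"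
    have sq: "\<beta> / (4 * of_real pi * \<i>) * (2 * of_real pi * \<i> * u)\<^sup>2 = of_real pi * \<i> * u\<^sup>2 * \<beta>"
      by (simp add: power2_eq_square field_simps)
    have "\<alpha> * (P * (2 * of_real pi * \<i> * u) * E t)
          + \<beta> / (4 * of_real pi * \<i>) * (P * (2 * of_real pi * \<i> * u)\<^sup>2 * E t)
        = P * E t * (\<alpha> * (2 * of_real pi * \<i> * u)
                     + \<beta> / (4 * of_real pi * \<i>) * (2 * of_real pi * \<i> * u)\<^sup>2)"
      by algebra
    thus ?thesis
      unfolding power_add power_one_right P_def[symmetric] sq by (simp add: algebra_simps)
  qed
  ultimately show ?thesis
    unfolding theta_term_def u_def E_def by simp
qed

text \<open>
  Moving \<open>z\<close> and \<open>\<tau>\<close> along a common complex line covers at once the derivative in \<open>z\<close>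
  (\<open>\<beta> = 0\<close>), the heat equation (\<open>\<alpha> = 0\<close>) and the total derivative at a torsion point that moves
  with the modulus.
\<close>

lemma theta_deriv_has_derivative_line:
  assumes "Im (\<beta> * t\<^sub>0 + \<sigma>) > 0"
  shows "((\<lambda>t. theta_deriv n a b (\<alpha> * t + w) (\<beta> * t + \<sigma>)) has_field_derivative
     (\<alpha> * theta_deriv (n + 1) a b (\<alpha> * t\<^sub>0 + w) (\<beta> * t\<^sub>0 + \<sigma>)
      + \<beta> / (4 * of_real pi * \<i>) * theta_deriv (n + 2) a b (\<alpha> * t\<^sub>0 + w) (\<beta> * t\<^sub>0 + \<sigma>))) (at t\<^sub>0)"
proof -
  define \<epsilon> where "\<epsilon> = Im (\<beta> * t\<^sub>0 + \<sigma>) / 2"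
  have \<epsilon>: "\<epsilon> > 0" using assms by (simp add: \<epsilon>_def)
  define r where "r = min 1 (\<epsilon> / (norm \<beta> + 1))"
  have r: "r > 0" "r \<le> 1" "r * (norm \<beta> + 1) \<le> \<epsilon>"
  proof -
    have "norm \<beta> + 1 > 0" by (simp add: add_nonneg_pos)
    moreover have "r \<le> \<epsilon> / (norm \<beta> + 1)" by (simp add: r_def)
    ultimately show "r * (norm \<beta> + 1) \<le> \<epsilon>" by (simp only: pos_le_divide_eq)
    show "r > 0" "r \<le> 1" using \<epsilon> \<open>norm \<beta> + 1 > 0\<close> by (auto simp: r_def)
  qed
  define S where "S = ball t\<^sub>0 r"
  have t0: "t\<^sub>0 \<in> S" "t\<^sub>0 \<in> interior S" using r by (auto simp: S_def)
  define R where "R = \<bar>Im (\<alpha> * t\<^sub>0 + w)\<bar> + norm \<alpha>"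
  have Im_tau: "Im (\<beta> * t + \<sigma>) \<ge> \<epsilon>" and Im_z: "\<bar>Im (\<alpha> * t + w)\<bar> \<le> R" if "t \<in> S" for t
  proof -
    have d: "norm (t - t\<^sub>0) \<le> r" using that by (simp add: S_def dist_norm norm_minus_commute)
    have "\<bar>Im (\<beta> * (t - t\<^sub>0))\<bar> \<le> norm \<beta> * norm (t - t\<^sub>0)" by (metis abs_Im_le_cmod norm_mult)
    also have "\<dots> \<le> (norm \<beta> + 1) * r" using d by (intro mult_mono) auto
    also have "\<dots> \<le> \<epsilon>" using r by (simp add: mult.commute)
    finally have "\<bar>Im (\<beta> * (t - t\<^sub>0))\<bar> \<le> \<epsilon>" .
    moreover have "Im (\<beta> * t + \<sigma>) = 2 * \<epsilon> + Im (\<beta> * (t - t\<^sub>0))"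
      by (simp add: \<epsilon>_def algebra_simps)
    ultimately show "Im (\<beta> * t + \<sigma>) \<ge> \<epsilon>" by linarith
    have "\<bar>Im (\<alpha> * (t - t\<^sub>0))\<bar> \<le> norm \<alpha> * norm (t - t\<^sub>0)" by (metis abs_Im_le_cmod norm_mult)
    also have "\<dots> \<le> norm \<alpha> * 1" using d r by (intro mult_left_mono) auto
    finally have "\<bar>Im (\<alpha> * (t - t\<^sub>0))\<bar> \<le> norm \<alpha>" by simp
    moreover have "Im (\<alpha> * t + w) = Im (\<alpha> * t\<^sub>0 + w) + Im (\<alpha> * (t - t\<^sub>0))"
      by (simp add: algebra_simps)
    ultimately show "\<bar>Im (\<alpha> * t + w)\<bar> \<le> R" unfolding R_def by linarith
  qed
  have pos: "Im (\<beta> * t + \<sigma>) > 0" if "t \<in> S" for t using Im_tau[OF that] \<epsilon> by linarith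
  define f where "f = (\<lambda>m t. theta_term n a b (\<alpha> * t + w) (\<beta> * t + \<sigma>) (int_decode m))"
  define f' where "f' = (\<lambda>m t. \<alpha> * theta_term (n + 1) a b (\<alpha> * t + w) (\<beta> * t + \<sigma>) (int_decode m)
      + \<beta> / (4 * of_real pi * \<i>) * theta_term (n + 2) a b (\<alpha> * t + w) (\<beta> * t + \<sigma>) (int_decode m))"
  have summ: "summable (\<lambda>m. exp (- \<bar>real_of_int (int_decode m)\<bar>))"
    using summable_on_imp_summable summable_exp_neg_abs_int
    by (simp add: summable_on_reindex_bij_betw[OF bij_int_decode, of "\<lambda>k. exp (- \<bar>real_of_int k\<bar>)", symmetric])
  obtain C1 where C1: "\<forall>k z \<tau>. \<epsilon> \<le> Im \<tau> \<and> \<bar>Im z\<bar> \<le> R \<longrightarrow>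
      norm (theta_term (n + 1) a b z \<tau> k) \<le> C1 * exp (- \<bar>of_int k\<bar>)"
    using theta_term_bound[OF \<epsilon>, of R "n + 1" a b] by (elim exE)
  obtain C2 where C2: "\<forall>k z \<tau>. \<epsilon> \<le> Im \<tau> \<and> \<bar>Im z\<bar> \<le> R \<longrightarrow>
      norm (theta_term (n + 2) a b z \<tau> k) \<le> C2 * exp (- \<bar>of_int k\<bar>)"
    using theta_term_bound[OF \<epsilon>, of R "n + 2" a b] by (elim exE)
  define M where "M = (\<lambda>m. (norm \<alpha> * C1 + norm (\<beta> / (4 * of_real pi * \<i>)) * C2)
                           * exp (- \<bar>real_of_int (int_decode m)\<bar>))"
  have "summable M" unfolding M_def by (intro summable_mult summ)
  have bound: "norm (f' m t) \<le> M m" if "t \<in> S" for m t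
  proof -
    have "norm (f' m t) \<le> norm \<alpha> * norm (theta_term (n + 1) a b (\<alpha> * t + w) (\<beta> * t + \<sigma>) (int_decode m))
       + norm (\<beta> / (4 * of_real pi * \<i>)) * norm (theta_term (n + 2) a b (\<alpha> * t + w) (\<beta> * t + \<sigma>) (int_decode m))"
      unfolding f'_def by (metis norm_mult norm_triangle_ineq)
    also have "\<dots> \<le> norm \<alpha> * (C1 * exp (- \<bar>of_int (int_decode m)\<bar>))
         + norm (\<beta> / (4 * of_real pi * \<i>)) * (C2 * exp (- \<bar>of_int (int_decode m)\<bar>))"
      using C1 C2 Im_tau[OF that] Im_z[OF that] by (intro add_mono mult_left_mono) auto
    finally show ?thesis by (simp add: M_def algebra_simps)
  qed
  have "((\<lambda>t. \<Sum>m. f m t) has_field_derivative (\<Sum>m. f' m t\<^sub>0)) (at t\<^sub>0)"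
  proof (rule has_field_derivative_series'(2)[where S = S and x0 = t\<^sub>0])
    show "convex S" by (simp add: S_def)
    show "(f m has_field_derivative f' m t) (at t within S)" if "t \<in> S" for m t
      unfolding f_def f'_def by (rule theta_term_has_derivative_line)
    show "uniformly_convergent_on S (\<lambda>m t. \<Sum>i<m. f' i t)"
      by (rule Weierstrass_m_test'[OF bound \<open>summable M\<close>])
    show "summable (\<lambda>m. f m t\<^sub>0)"
      unfolding f_def using theta_deriv_sums[OF assms] by (rule sums_summable)
  qed (use t0 in auto)
  moreover have "(\<Sum>m. f' m t\<^sub>0) = \<alpha> * theta_deriv (n + 1) a b (\<alpha> * t\<^sub>0 + w) (\<beta> * t\<^sub>0 + \<sigma>)
      + \<beta> / (4 * of_real pi * \<i>) * theta_deriv (n + 2) a b (\<alpha> * t\<^sub>0 + w) (\<beta> * t\<^sub>0 + \<sigma>)"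
    unfolding f'_def by (intro sums_unique[symmetric] sums_add sums_mult theta_deriv_sums assms)
  moreover have "(\<Sum>m. f m t) = theta_deriv n a b (\<alpha> * t + w) (\<beta> * t + \<sigma>)" if "t \<in> S" for t
    unfolding f_def by (intro sums_unique[symmetric] theta_deriv_sums pos that)
  ultimately show ?thesis
    using has_field_derivative_transform_within_open[where S = S and f = "\<lambda>t. \<Sum>m. f m t"] t0
    by (auto simp: S_def)
qed

lemma theta_deriv_has_derivative:
  assumes "Im \<tau> > 0"
  shows "((\<lambda>z. theta_deriv n a b z \<tau>) has_field_derivative theta_deriv (Suc n) a b z \<tau>) (at z within S)"
  using theta_deriv_has_derivative_line[of 0 z \<tau> n a b 1 0] assms
  by (auto intro: has_field_derivative_at_within)

lemma theta_deriv_DERIV_chain [derivative_intros]: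
  assumes "Im \<tau> > 0" "(g has_field_derivative g') (at z within S)"
    "theta_deriv (Suc n) a b (g z) \<tau> * g' = D"
  shows "((\<lambda>z. theta_deriv n a b (g z) \<tau>) has_field_derivative D) (at z within S)"
  using DERIV_chain2[OF theta_deriv_has_derivative[OF assms(1)] assms(2), of n a b] assms(3) by simp

section \<open>Products of theta functions and duplication\<close>

lemma has_sum_product_complex:
  fixes f g :: "int \<Rightarrow> complex"
  assumes f: "(\<lambda>k. norm (f k)) summable_on UNIV" and g: "(\<lambda>k. norm (g k)) summable_on UNIV"
    and "(f has_sum F) UNIV" "(g has_sum G) UNIV"
  shows "((\<lambda>(k, l). f k * g l) has_sum F * G) UNIV"
proof -
  have "(\<lambda>(k, l). norm (f k) * norm (g l)) summable_on (UNIV \<times> UNIV)"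
    by (rule summable_on_SigmaI[where g = "\<lambda>k. norm (f k) * (\<Sum>\<^sub>\<infinity>l. norm (g l))"])
       (use f g in \<open>auto intro!: has_sum_cmult_right has_sum_infsum summable_on_cmult_left\<close>)
  hence "(\<lambda>p. norm (case p of (k, l) \<Rightarrow> f k * g l)) summable_on (UNIV \<times> UNIV)"
    by (simp add: case_prod_unfold norm_mult)
  hence summ: "(\<lambda>(k, l). f k * g l) summable_on (UNIV \<times> UNIV)"
    by (rule abs_summable_summable)
  have "((\<lambda>(k, l). f k * g l) has_sum F * G) (UNIV \<times> UNIV)"
    by (rule has_sum_SigmaI[where g = "\<lambda>k. f k * G"])
       (use assms summ in \<open>auto intro!: has_sum_cmult_right has_sum_cmult_left\<close>)
  thus ?thesis by simp
qed

lemma theta_term_mult_even: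
  "theta_term 0 a b x \<tau> (m + n) * theta_term 0 a d y \<tau> (m - n)
     = theta_term 0 a (b + d) (x + y) (2 * \<tau>) m * theta_term 0 0 (b - d) (x - y) (2 * \<tau>) n"
  unfolding theta_term_def mult_exp_exp power_0 mult_1_left
  by (rule arg_cong[of _ _ exp]) (simp add: power2_eq_square field_simps)

lemma theta_term_mult_odd:
  "theta_term 0 a b x \<tau> (m + n + 1) * theta_term 0 a d y \<tau> (m - n)
     = theta_term 0 (a + 1) (b + d) (x + y) (2 * \<tau>) m * theta_term 0 1 (b - d) (x - y) (2 * \<tau>) n"
  unfolding theta_term_def mult_exp_exp power_0 mult_1_left
  by (rule arg_cong[of _ _ exp]) (simp add: power2_eq_square field_simps)

text \<open>
  In the double sum over \<open>(k, l)\<close> substitute \<open>(m + n, m - n)\<close> when \<open>k + l\<close> is even and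
  \<open>(m + n + 1, m - n)\<close> when it is odd. Since \<open>k\<^sup>2 + l\<^sup>2\<close> becomes twice a sum of two squares, both parts
  factor into theta functions of modulus \<open>2 \<tau>\<close> at \<open>x + y\<close> and \<open>x - y\<close>.
\<close>

theorem theta_deriv_0_mult:
  assumes "Im \<tau> > 0"
  shows "theta_deriv 0 a b x \<tau> * theta_deriv 0 a d y \<tau>
     = theta_deriv 0 a (b + d) (x + y) (2 * \<tau>) * theta_deriv 0 0 (b - d) (x - y) (2 * \<tau>)
     + theta_deriv 0 (a + 1) (b + d) (x + y) (2 * \<tau>) * theta_deriv 0 1 (b - d) (x - y) (2 * \<tau>)"
    (is "_ = ?E + ?O")
proof -
  have \<tau>2: "Im (2 * \<tau>) > 0" using assms by simp
  define h where "h = (\<lambda>(k, l). theta_term 0 a b x \<tau> k * theta_term 0 a d y \<tau> l)"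
  define even_idx :: "int \<times> int \<Rightarrow> int \<times> int" where "even_idx = (\<lambda>(m, n). (m + n, m - n))"
  define odd_idx :: "int \<times> int \<Rightarrow> int \<times> int" where "odd_idx = (\<lambda>(m, n). (m + n + 1, m - n))"
  have "inj even_idx" "inj odd_idx" by (auto simp: inj_def even_idx_def odd_idx_def)
  have hsum: "(h has_sum (theta_deriv 0 a b x \<tau> * theta_deriv 0 a d y \<tau>)) UNIV"
    unfolding h_def by (intro has_sum_product_complex theta_term_abs_summable theta_deriv_has_sum assms)
  have "((h \<circ> even_idx) has_sum ?E) UNIV"
  proof -
    have "h \<circ> even_idx = (\<lambda>(m, n). theta_term 0 a (b + d) (x + y) (2 * \<tau>) m * theta_term 0 0 (b - d) (x - y) (2 * \<tau>) n)"
      by (auto simp: h_def even_idx_def theta_term_mult_even)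
    thus ?thesis
      by (simp only:) (intro has_sum_product_complex theta_term_abs_summable theta_deriv_has_sum \<tau>2)
  qed
  hence E: "(h has_sum ?E) (range even_idx)" using has_sum_reindex[OF \<open>inj even_idx\<close>] by blast
  have "((h \<circ> odd_idx) has_sum ?O) UNIV"
  proof -
    have "h \<circ> odd_idx = (\<lambda>(m, n). theta_term 0 (a + 1) (b + d) (x + y) (2 * \<tau>) m * theta_term 0 1 (b - d) (x - y) (2 * \<tau>) n)"
      by (auto simp: h_def odd_idx_def theta_term_mult_odd)
    thus ?thesis
      by (simp only:) (intro has_sum_product_complex theta_term_abs_summable theta_deriv_has_sum \<tau>2)
  qed
  hence O: "(h has_sum ?O) (range odd_idx)" using has_sum_reindex[OF \<open>inj odd_idx\<close>] by blast
  have disj: "range even_idx \<inter> range odd_idx = {}"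
  proof -
    have "even (fst p + snd p)" if "p \<in> range even_idx" for p using that by (auto simp: even_idx_def)
    moreover have "odd (fst p + snd p)" if "p \<in> range odd_idx" for p using that by (auto simp: odd_idx_def)
    ultimately show ?thesis by blast
  qed
  have un: "range even_idx \<union> range odd_idx = UNIV"
  proof (intro set_eqI iffI UNIV_I)
    fix p :: "int \<times> int"
    obtain k l where p: "p = (k, l)" by fastforce
    show "p \<in> range even_idx \<union> range odd_idx"
    proof (cases "even (k + l)")
      case True
      then obtain m where "k + l = 2 * m" by (elim evenE)
      hence "p = even_idx (m, m - l)" by (simp add: p even_idx_def)
      thus ?thesis by blast
    next
      case False
      then obtain m where "k + l = 2 * m + 1" by (elim oddE)
      hence "p = odd_idx (m, m - l)" by (simp add: p odd_idx_def)
      thus ?thesis by blast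
    qed
  qed
  have "(h has_sum (?E + ?O)) UNIV"
    using has_sum_Un_disjoint[OF E O disj] by (simp add: un)
  with hsum show ?thesis by (rule has_sum_unique)
qed

lemma theta_deriv_add_even_left:
  "theta_deriv n (a + 2 * m) b z \<tau> = theta_deriv n a b z \<tau>"
proof -
  have "theta_term n (a + 2 * m) b z \<tau> = (\<lambda>k. theta_term n a b z \<tau> (k + m))"
    by (rule ext) (simp add: theta_term_def add_divide_distrib add_ac)
  moreover have "bij_betw (\<lambda>k::int. k + m) UNIV UNIV"
    by (rule bij_betwI[where g = "\<lambda>k. k - m"]) auto
  ultimately show ?thesis
    unfolding theta_deriv_def using infsum_reindex_bij_betw[of "\<lambda>k. k + m" UNIV UNIV "theta_term n a b z \<tau>"] by simp
qed

lemma theta_deriv_add_even_right: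
  "theta_deriv n a (b + 2 * m) z \<tau> = exp (of_real pi * \<i> * of_int (a * m)) * theta_deriv n a b z \<tau>"
proof -
  have "theta_term n a (b + 2 * m) z \<tau> k
      = exp (of_real pi * \<i> * of_int (a * m)) * theta_term n a b z \<tau> k" for k
  proof -
    define u where "u = (of_int k + of_int a / 2 :: complex)"
    have "of_real pi * \<i> * u\<^sup>2 * \<tau> + 2 * of_real pi * \<i> * u * (z + of_int (b + 2 * m) / 2)
       = (2 * of_int (k * m) * of_real pi) * \<i> + (of_real pi * \<i> * of_int (a * m)
          + (of_real pi * \<i> * u\<^sup>2 * \<tau> + 2 * of_real pi * \<i> * u * (z + of_int b / 2)))"
      by (simp add: u_def field_simps)
    moreover have "exp ((2 * of_int (k * m) * of_real pi) * \<i>) = (1 :: complex)"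
      using exp_integer_2pi[of "of_int (k * m)"] by (simp add: mult_ac)
    ultimately show ?thesis
      unfolding theta_term_def u_def[symmetric] by (simp only: exp_add) (simp add: mult_ac)
  qed
  thus ?thesis unfolding theta_deriv_def infsum_cmult_right'[symmetric] by (intro infsum_cong)
qed

lemma theta_deriv_minus:
  "theta_deriv n (- a) (- b) (- z) \<tau> = (- 1) ^ n * theta_deriv n a b z \<tau>"
proof -
  have "theta_term n (- a) (- b) (- z) \<tau> (- k) = (- 1) ^ n * theta_term n a b z \<tau> k" for k
  proof -
    define u where "u = (of_int k + of_int a / 2 :: complex)"
    have "of_int (- k) + of_int (- a) / 2 = - u" by (simp add: u_def)
    moreover have p: "(2 * of_real pi * \<i> * - u) ^ n = (- 1) ^ n * (2 * of_real pi * \<i> * u) ^ n"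
      by (metis mult_minus_right power_minus)
    moreover have e: "of_real pi * \<i> * (- u)\<^sup>2 * \<tau> + 2 * of_real pi * \<i> * - u * (- z + of_int (- b) / 2)
        = of_real pi * \<i> * u\<^sup>2 * \<tau> + 2 * of_real pi * \<i> * u * (z + of_int b / 2)"
      by (simp add: power2_eq_square algebra_simps)
    ultimately show ?thesis
      unfolding theta_term_def u_def[symmetric] by (simp only: mult.assoc)
  qed
  moreover have "bij_betw (\<lambda>k::int. - k) UNIV UNIV"
    by (rule bij_betwI[where g = "\<lambda>k. - k"]) auto
  ultimately show ?thesis
    unfolding theta_deriv_def
    using infsum_reindex_bij_betw[of "\<lambda>k. - k" UNIV UNIV "theta_term n (- a) (- b) (- z) \<tau>"]
    by (simp only: infsum_cmult_right')
qed

lemma theta_deriv_0_half_period: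
  "theta_deriv 0 a b (z + of_int m / 2 * \<tau> + of_int n / 2) \<tau>
     = exp (- (of_real pi * \<i> * (of_int m)\<^sup>2 / 4 * \<tau>) - of_real pi * \<i> * of_int m * (z + of_int (b + n) / 2))
       * theta_deriv 0 (a + m) (b + n) z \<tau>"
proof -
  have "theta_term 0 a b (z + of_int m / 2 * \<tau> + of_int n / 2) \<tau> k
     = exp (- (of_real pi * \<i> * (of_int m)\<^sup>2 / 4 * \<tau>) - of_real pi * \<i> * of_int m * (z + of_int (b + n) / 2))
       * theta_term 0 (a + m) (b + n) z \<tau> k" for k
    unfolding theta_term_def mult_exp_exp power_0 mult_1_left
    by (rule arg_cong[of _ _ exp]) (simp add: power2_eq_square field_simps)
  thus ?thesis unfolding theta_deriv_def infsum_cmult_right'[symmetric] by (intro infsum_cong)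
qed

text \<open>
  \<open>z\<close>-derivatives of the four Jacobi theta functions. The zeroth ones are the functions
  themselves, and at \<open>z = 0\<close> they are the theta constants.
\<close>

definition "dtheta1 n z \<tau> = - theta_deriv n 1 1 z \<tau>"
definition "dtheta2 n z \<tau> = theta_deriv n 1 0 z \<tau>"
definition "dtheta3 n z \<tau> = theta_deriv n 0 0 z \<tau>"
definition "dtheta4 n z \<tau> = theta_deriv n 0 1 z \<tau>"

lemmas dtheta_defs = dtheta1_def dtheta2_def dtheta3_def dtheta4_def

lemma theta_eq_dtheta_0:
  "theta1 z \<tau> = dtheta1 0 z \<tau>" "theta2 z \<tau> = dtheta2 0 z \<tau>"
  "theta3 z \<tau> = dtheta3 0 z \<tau>" "theta4 z \<tau> = dtheta4 0 z \<tau>"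
  by (simp_all add: theta1_def theta2_def theta3_def theta4_def dtheta_defs theta_char_eq_theta_deriv)

lemma DERIV_dtheta [derivative_intros]:
  assumes "Im \<tau> > 0" "(g has_field_derivative g') (at z within S)"
  shows "dtheta1 (Suc n) (g z) \<tau> * g' = D \<Longrightarrow> ((\<lambda>z. dtheta1 n (g z) \<tau>) has_field_derivative D) (at z within S)"
    and "dtheta2 (Suc n) (g z) \<tau> * g' = D \<Longrightarrow> ((\<lambda>z. dtheta2 n (g z) \<tau>) has_field_derivative D) (at z within S)"
    and "dtheta3 (Suc n) (g z) \<tau> * g' = D \<Longrightarrow> ((\<lambda>z. dtheta3 n (g z) \<tau>) has_field_derivative D) (at z within S)"
    and "dtheta4 (Suc n) (g z) \<tau> * g' = D \<Longrightarrow> ((\<lambda>z. dtheta4 n (g z) \<tau>) has_field_derivative D) (at z within S)"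
  unfolding dtheta_defs using assms by (auto intro!: derivative_eq_intros)

lemma dtheta_minus:
  "dtheta1 n (- z) \<tau> = - ((- 1) ^ n * dtheta1 n z \<tau>)"
  "dtheta2 n (- z) \<tau> = (- 1) ^ n * dtheta2 n z \<tau>"
  "dtheta3 n (- z) \<tau> = (- 1) ^ n * dtheta3 n z \<tau>"
  "dtheta4 n (- z) \<tau> = (- 1) ^ n * dtheta4 n z \<tau>"
  using theta_deriv_minus[of n "-1" "-1" z \<tau>] theta_deriv_minus[of n "-1" 0 z \<tau>]
    theta_deriv_minus[of n 0 0 z \<tau>] theta_deriv_minus[of n 0 "-1" z \<tau>]
    theta_deriv_add_even_left[of n "-1" 1 "-1" z \<tau>] theta_deriv_add_even_left[of n "-1" 1 0 z \<tau>]
    theta_deriv_add_even_right[of n 1 "-1" 1 z \<tau>] theta_deriv_add_even_right[of n 0 "-1" 1 z \<tau>]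
  by (simp_all add: dtheta_defs)

lemma dtheta_0 [simp]:
  "dtheta1 0 0 \<tau> = 0"
  "dtheta2 (Suc 0) 0 \<tau> = 0" "dtheta3 (Suc 0) 0 \<tau> = 0" "dtheta4 (Suc 0) 0 \<tau> = 0"
  using dtheta_minus(1)[of 0 0 \<tau>] dtheta_minus(2-4)[of 1 0 \<tau>]
  by (simp_all add: eq_neg_iff_add_eq_0 neg_eq_iff_add_eq_0)

lemma dtheta_mult:
  assumes "Im \<tau> > 0"
  shows dtheta1_mult_dtheta1: "dtheta1 0 x \<tau> * dtheta1 0 y \<tau> =
      dtheta3 0 (x + y) (2 * \<tau>) * dtheta2 0 (x - y) (2 * \<tau>) - dtheta2 0 (x + y) (2 * \<tau>) * dtheta3 0 (x - y) (2 * \<tau>)"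
    and dtheta2_mult_dtheta2: "dtheta2 0 x \<tau> * dtheta2 0 y \<tau> =
      dtheta2 0 (x + y) (2 * \<tau>) * dtheta3 0 (x - y) (2 * \<tau>) + dtheta3 0 (x + y) (2 * \<tau>) * dtheta2 0 (x - y) (2 * \<tau>)"
    and dtheta3_mult_dtheta3: "dtheta3 0 x \<tau> * dtheta3 0 y \<tau> =
      dtheta3 0 (x + y) (2 * \<tau>) * dtheta3 0 (x - y) (2 * \<tau>) + dtheta2 0 (x + y) (2 * \<tau>) * dtheta2 0 (x - y) (2 * \<tau>)"
    and dtheta4_mult_dtheta4: "dtheta4 0 x \<tau> * dtheta4 0 y \<tau> =
      dtheta3 0 (x + y) (2 * \<tau>) * dtheta3 0 (x - y) (2 * \<tau>) - dtheta2 0 (x + y) (2 * \<tau>) * dtheta2 0 (x - y) (2 * \<tau>)"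
    and dtheta1_mult_dtheta2: "dtheta1 0 x \<tau> * dtheta2 0 y \<tau> =
      dtheta1 0 (x + y) (2 * \<tau>) * dtheta4 0 (x - y) (2 * \<tau>) + dtheta4 0 (x + y) (2 * \<tau>) * dtheta1 0 (x - y) (2 * \<tau>)"
    and dtheta3_mult_dtheta4: "dtheta3 0 x \<tau> * dtheta4 0 y \<tau> =
      dtheta4 0 (x + y) (2 * \<tau>) * dtheta4 0 (x - y) (2 * \<tau>) - dtheta1 0 (x + y) (2 * \<tau>) * dtheta1 0 (x - y) (2 * \<tau>)"
proof -
  have r: "theta_deriv 0 2 b z \<sigma> = theta_deriv 0 0 b z \<sigma>"
    "theta_deriv 0 0 2 z \<sigma> = theta_deriv 0 0 0 z \<sigma>"
    "theta_deriv 0 1 2 z \<sigma> = - theta_deriv 0 1 0 z \<sigma>"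
    "theta_deriv 0 0 (-1) z \<sigma> = theta_deriv 0 0 1 z \<sigma>"
    "theta_deriv 0 1 (-1) z \<sigma> = - theta_deriv 0 1 1 z \<sigma>" for b z \<sigma>
    using theta_deriv_add_even_left[of 0 0 1 b z \<sigma>] theta_deriv_add_even_right[of 0 0 0 1 z \<sigma>]
      theta_deriv_add_even_right[of 0 1 0 1 z \<sigma>] theta_deriv_add_even_right[of 0 0 1 "-1" z \<sigma>]
      theta_deriv_add_even_right[of 0 1 1 "-1" z \<sigma>]
    by (simp_all add: exp_minus)
  note m = theta_deriv_0_mult[OF assms, of _ _ x _ y]
  show "dtheta1 0 x \<tau> * dtheta1 0 y \<tau> =
      dtheta3 0 (x + y) (2 * \<tau>) * dtheta2 0 (x - y) (2 * \<tau>) - dtheta2 0 (x + y) (2 * \<tau>) * dtheta3 0 (x - y) (2 * \<tau>)"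
    using m[of 1 1 1] by (simp add: dtheta_defs r)
  show "dtheta2 0 x \<tau> * dtheta2 0 y \<tau> =
      dtheta2 0 (x + y) (2 * \<tau>) * dtheta3 0 (x - y) (2 * \<tau>) + dtheta3 0 (x + y) (2 * \<tau>) * dtheta2 0 (x - y) (2 * \<tau>)"
    using m[of 1 0 0] by (simp add: dtheta_defs r)
  show "dtheta3 0 x \<tau> * dtheta3 0 y \<tau> =
      dtheta3 0 (x + y) (2 * \<tau>) * dtheta3 0 (x - y) (2 * \<tau>) + dtheta2 0 (x + y) (2 * \<tau>) * dtheta2 0 (x - y) (2 * \<tau>)"
    using m[of 0 0 0] by (simp add: dtheta_defs r)
  show "dtheta4 0 x \<tau> * dtheta4 0 y \<tau> =
      dtheta3 0 (x + y) (2 * \<tau>) * dtheta3 0 (x - y) (2 * \<tau>) - dtheta2 0 (x + y) (2 * \<tau>) * dtheta2 0 (x - y) (2 * \<tau>)"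
    using m[of 0 1 1] by (simp add: dtheta_defs r)
  show "dtheta1 0 x \<tau> * dtheta2 0 y \<tau> =
      dtheta1 0 (x + y) (2 * \<tau>) * dtheta4 0 (x - y) (2 * \<tau>) + dtheta4 0 (x + y) (2 * \<tau>) * dtheta1 0 (x - y) (2 * \<tau>)"
    using m[of 1 1 0] by (simp add: dtheta_defs r)
  show "dtheta3 0 x \<tau> * dtheta4 0 y \<tau> =
      dtheta4 0 (x + y) (2 * \<tau>) * dtheta4 0 (x - y) (2 * \<tau>) - dtheta1 0 (x + y) (2 * \<tau>) * dtheta1 0 (x - y) (2 * \<tau>)"
    using m[of 0 0 1] by (simp add: dtheta_defs r)
qed

text \<open>
  All squares are linear in the two functions \<open>\<theta>\<^sub>3(2z|2\<tau>)\<close> and \<open>\<theta>\<^sub>2(2z|2\<tau>)\<close>, so any three of them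
  are linearly dependent.
\<close>

lemma dtheta_squares:
  assumes "Im \<tau> > 0"
  shows "(dtheta2 0 0 \<tau>)\<^sup>2 * (dtheta4 0 z \<tau>)\<^sup>2 = (dtheta4 0 0 \<tau>)\<^sup>2 * (dtheta2 0 z \<tau>)\<^sup>2 + (dtheta3 0 0 \<tau>)\<^sup>2 * (dtheta1 0 z \<tau>)\<^sup>2"
    and "(dtheta2 0 0 \<tau>)\<^sup>2 * (dtheta3 0 z \<tau>)\<^sup>2 = (dtheta3 0 0 \<tau>)\<^sup>2 * (dtheta2 0 z \<tau>)\<^sup>2 + (dtheta4 0 0 \<tau>)\<^sup>2 * (dtheta1 0 z \<tau>)\<^sup>2"
proof -
  define A B P Q where "A = dtheta3 0 0 (2 * \<tau>)" and "B = dtheta2 0 0 (2 * \<tau>)"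
    and "P = dtheta3 0 (2 * z) (2 * \<tau>)" and "Q = dtheta2 0 (2 * z) (2 * \<tau>)"
  have sq: "(dtheta1 0 z \<tau>)\<^sup>2 = P * B - Q * A" "(dtheta2 0 z \<tau>)\<^sup>2 = Q * A + P * B"
    "(dtheta3 0 z \<tau>)\<^sup>2 = P * A + Q * B" "(dtheta4 0 z \<tau>)\<^sup>2 = P * A - Q * B"
    using dtheta_mult(1-4)[OF assms, of z z] by (simp_all add: power2_eq_square A_def B_def P_def Q_def)
  have sq0: "(dtheta2 0 0 \<tau>)\<^sup>2 = B * A + A * B"
    "(dtheta3 0 0 \<tau>)\<^sup>2 = A * A + B * B" "(dtheta4 0 0 \<tau>)\<^sup>2 = A * A - B * B"
    using dtheta_mult(2-4)[OF assms, of 0 0] by (simp_all add: power2_eq_square A_def B_def)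
  show "(dtheta2 0 0 \<tau>)\<^sup>2 * (dtheta4 0 z \<tau>)\<^sup>2 = (dtheta4 0 0 \<tau>)\<^sup>2 * (dtheta2 0 z \<tau>)\<^sup>2 + (dtheta3 0 0 \<tau>)\<^sup>2 * (dtheta1 0 z \<tau>)\<^sup>2"
    and "(dtheta2 0 0 \<tau>)\<^sup>2 * (dtheta3 0 z \<tau>)\<^sup>2 = (dtheta3 0 0 \<tau>)\<^sup>2 * (dtheta2 0 z \<tau>)\<^sup>2 + (dtheta4 0 0 \<tau>)\<^sup>2 * (dtheta1 0 z \<tau>)\<^sup>2"
    unfolding sq sq0 by algebra+
qed

lemma dtheta_duplication_0:
  assumes "Im \<tau> > 0"
  shows "dtheta3 0 0 \<tau> * dtheta4 0 0 \<tau> = (dtheta4 0 0 (2 * \<tau>))\<^sup>2"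
    and "(dtheta2 0 0 \<tau>)\<^sup>2 = 2 * dtheta2 0 0 (2 * \<tau>) * dtheta3 0 0 (2 * \<tau>)"
  using dtheta3_mult_dtheta4[OF assms, of 0 0] dtheta2_mult_dtheta2[OF assms, of 0 0]
  by (simp_all add: power2_eq_square)

lemma dtheta_duplication:
  assumes "Im \<tau> > 0"
  shows "dtheta1 0 z \<tau> * dtheta2 0 z \<tau> = dtheta1 0 (2 * z) (2 * \<tau>) * dtheta4 0 0 (2 * \<tau>)"
    and "dtheta3 0 z \<tau> * dtheta4 0 z \<tau> = dtheta4 0 (2 * z) (2 * \<tau>) * dtheta4 0 0 (2 * \<tau>)"
  using dtheta1_mult_dtheta2[OF assms, of z z] dtheta3_mult_dtheta4[OF assms, of z z]
  by simp_all

lemma jacobi_quartic: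
  assumes "Im \<tau> > 0"
  shows "dtheta3 0 0 \<tau> ^ 4 = dtheta2 0 0 \<tau> ^ 4 + dtheta4 0 0 \<tau> ^ 4"
proof -
  define A B where "A = dtheta3 0 0 (2 * \<tau>)" and "B = dtheta2 0 0 (2 * \<tau>)"
  have sq0: "(dtheta2 0 0 \<tau>)\<^sup>2 = B * A + A * B"
    "(dtheta3 0 0 \<tau>)\<^sup>2 = A * A + B * B" "(dtheta4 0 0 \<tau>)\<^sup>2 = A * A - B * B"
    using dtheta_mult(2-4)[OF assms, of 0 0] by (simp_all add: power2_eq_square A_def B_def)
  have quartic: "x ^ 4 = (x\<^sup>2)\<^sup>2" for x :: complex by (simp flip: power_mult)
  show ?thesis unfolding quartic sq0 by algebra
qed

section \<open>Asymptotics under doubling of the modulus\<close>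

lemma norm_theta_term_affine:
  fixes a b :: real
  shows "norm (theta_term n c d (of_real a * \<tau> + of_real b) \<tau> k) =
     (2 * pi * \<bar>of_int k + of_int c / 2\<bar>) ^ n
     * exp (- pi * Im \<tau> * ((of_int k + of_int c / 2 + a)\<^sup>2 - a\<^sup>2))"
  unfolding norm_theta_term by (simp add: power2_eq_square algebra_simps)

text \<open>
  Each term decays in \<open>Im \<tau>\<close> at least like \<open>exp (- \<pi> (M - a\<^sup>2) Im \<tau>)\<close>, so the sum at \<open>\<tau>\<close> is
  compared termwise with the sum at \<open>i t\<close>. The real shift \<open>b\<close> only contributes unimodular factors,
  which is why the bound is uniform in \<open>b\<close>.
\<close>

lemma theta_tail_bound:
  fixes a M :: real
  assumes "t > 0" and M: "\<And>k. k \<in> K \<Longrightarrow> M \<le> (of_int k + of_int c / 2 + a)\<^sup>2"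
  shows "\<exists>G. \<forall>\<tau> b. t \<le> Im \<tau> \<longrightarrow>
     norm (\<Sum>\<^sub>\<infinity>k\<in>K. theta_term n c d (of_real a * \<tau> + of_real b) \<tau> k) \<le> G * exp (- pi * Im \<tau> * (M - a\<^sup>2))"
proof -
  define p where "p = (\<lambda>k. norm (theta_term n c d (of_real a * (\<i> * t) + of_real 0) (\<i> * t) k))"
  define G where "G = (\<Sum>\<^sub>\<infinity>k\<in>K. p k) * exp (pi * t * (M - a\<^sup>2))"
  have p: "p summable_on K"
    unfolding p_def using \<open>t > 0\<close>
    by (intro summable_on_subset[OF theta_term_abs_summable]) auto
  have "norm (\<Sum>\<^sub>\<infinity>k\<in>K. theta_term n c d (of_real a * \<tau> + of_real b) \<tau> k) \<le> G * exp (- pi * Im \<tau> * (M - a\<^sup>2))"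
    if \<tau>: "t \<le> Im \<tau>" for \<tau> b
  proof -
    define q where "q = exp (- pi * (Im \<tau> - t) * (M - a\<^sup>2))"
    have abs: "(\<lambda>k. norm (theta_term n c d (of_real a * \<tau> + of_real b) \<tau> k)) summable_on K"
      using \<tau> \<open>t > 0\<close> by (intro summable_on_subset[OF theta_term_abs_summable]) auto
    have le: "norm (theta_term n c d (of_real a * \<tau> + of_real b) \<tau> k) \<le> p k * q" if "k \<in> K" for k
    proof -
      define e where "e = (of_int k + of_int c / 2 + a)\<^sup>2 - a\<^sup>2"
      define P where "P = (2 * pi * \<bar>of_int k + of_int c / 2\<bar>) ^ n"
      have "P \<ge> 0" by (simp add: P_def)
      have "(Im \<tau> - t) * (M - a\<^sup>2) \<le> (Im \<tau> - t) * e"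
        unfolding e_def using M[OF that] \<tau> by (intro mult_left_mono) auto
      from mult_left_mono[OF this pi_ge_zero]
      have ex: "- pi * (Im \<tau> - t) * e \<le> - pi * (Im \<tau> - t) * (M - a\<^sup>2)"
        by (simp only: mult.assoc mult_minus_left neg_le_iff_le)
      have "norm (theta_term n c d (of_real a * \<tau> + of_real b) \<tau> k) = P * exp (- pi * Im \<tau> * e)"
        unfolding norm_theta_term_affine P_def e_def ..
      also have "- pi * Im \<tau> * e = - pi * t * e + - pi * (Im \<tau> - t) * e"
        by (simp add: algebra_simps)
      also have "P * exp \<dots> = P * exp (- pi * t * e) * exp (- pi * (Im \<tau> - t) * e)"
        unfolding exp_add by simp
      also have "\<dots> \<le> P * exp (- pi * t * e) * q"
        unfolding q_def using ex \<open>P \<ge> 0\<close> by (intro mult_left_mono) auto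
      also have "P * exp (- pi * t * e) = p k"
        unfolding p_def norm_theta_term_affine P_def e_def by simp
      finally show ?thesis .
    qed
    have "norm (\<Sum>\<^sub>\<infinity>k\<in>K. theta_term n c d (of_real a * \<tau> + of_real b) \<tau> k)
        \<le> (\<Sum>\<^sub>\<infinity>k\<in>K. norm (theta_term n c d (of_real a * \<tau> + of_real b) \<tau> k))"
      by (rule norm_infsum_bound[OF abs])
    also have "\<dots> \<le> (\<Sum>\<^sub>\<infinity>k\<in>K. p k * q)"
      by (intro infsum_mono abs summable_on_cmult_left p le)
    also have "\<dots> = (\<Sum>\<^sub>\<infinity>k\<in>K. p k) * q" by (simp add: infsum_cmult_left')
    also have "\<dots> = G * exp (- pi * Im \<tau> * (M - a\<^sup>2))"
    proof -
      have "q = exp (pi * t * (M - a\<^sup>2)) * exp (- pi * Im \<tau> * (M - a\<^sup>2))"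
        unfolding q_def mult_exp_exp by (simp add: algebra_simps)
      thus ?thesis by (simp add: G_def)
    qed
    finally show ?thesis .
  qed
  thus ?thesis by blast
qed

lemma theta_deriv_split:
  assumes "Im \<tau> > 0" "finite F"
  shows "theta_deriv n c d z \<tau> = (\<Sum>k\<in>F. theta_term n c d z \<tau> k) + (\<Sum>\<^sub>\<infinity>k\<in>-F. theta_term n c d z \<tau> k)"
proof -
  have "infsum (theta_term n c d z \<tau>) (F \<union> - F)
      = infsum (theta_term n c d z \<tau>) F + infsum (theta_term n c d z \<tau>) (- F)"
    by (intro infsum_Un_disjoint theta_term_summable assms) auto
  thus ?thesis using assms(2) by (simp add: theta_deriv_def)
qed

text \<open>
  Only the terms with index in \<open>F\<close>, whose exponents are the smallest, contribute to the limit
  after normalisation by \<open>E\<close>. The real parts \<open>b j\<close> may vary with \<open>j\<close>: doubling a point doubles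
  them without any control modulo the lattice.
\<close>

lemma theta_deriv_asymptotics:
  fixes a m M :: real and b :: "nat \<Rightarrow> real"
  assumes "Im \<tau> > 0" "finite F" "m < M"
    and M: "\<And>k. k \<notin> F \<Longrightarrow> M \<le> (of_int k + of_int c / 2 + a)\<^sup>2"
    and E: "\<And>j. norm (E j) = exp (pi * Im (2 ^ j * \<tau>) * (m - a\<^sup>2))"
  shows "(\<lambda>j. (theta_deriv n c d (of_real a * (2 ^ j * \<tau>) + of_real (b j)) (2 ^ j * \<tau>)
               - (\<Sum>k\<in>F. theta_term n c d (of_real a * (2 ^ j * \<tau>) + of_real (b j)) (2 ^ j * \<tau>) k)) * E j)
         \<longlonglongrightarrow> 0"
proof -
  define \<sigma> where "\<sigma> = (\<lambda>j::nat. 2 ^ j * \<tau>)"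
  have Im_\<sigma>: "Im (\<sigma> j) = 2 ^ j * Im \<tau>" for j
  proof -
    have "\<sigma> j = of_real (2 ^ j) * \<tau>" by (simp add: \<sigma>_def)
    thus ?thesis by (simp only: Im_complex_of_real Re_complex_of_real times_complex.sel)
  qed
  have ge: "Im \<tau> \<le> Im (\<sigma> j)" for j
    using assms(1) mult_right_mono[of 1 "2 ^ j" "Im \<tau>"] by (simp add: Im_\<sigma>)
  have pow: "filterlim (\<lambda>j. (2 :: real) ^ j) at_top sequentially"
    by (rule filterlim_at_top_mono[OF filterlim_real_sequentially])
       (auto intro!: always_eventually less_imp_le of_nat_less_two_power)
  have lim: "filterlim (\<lambda>j. Im (\<sigma> j)) at_top sequentially"
    unfolding Im_\<sigma> using assms(1)
    by (intro filterlim_at_top_mult_tendsto_pos[OF tendsto_const] pow) auto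
  define T where "T = (\<lambda>j. \<Sum>\<^sub>\<infinity>k\<in>-F. theta_term n c d (of_real a * \<sigma> j + of_real (b j)) (\<sigma> j) k)"
  have T: "theta_deriv n c d (of_real a * \<sigma> j + of_real (b j)) (\<sigma> j)
      - (\<Sum>k\<in>F. theta_term n c d (of_real a * \<sigma> j + of_real (b j)) (\<sigma> j) k) = T j" for j
    using theta_deriv_split[of "\<sigma> j" F] ge[of j] assms(1,2) by (simp add: T_def)
  have "\<exists>G. \<forall>\<sigma> b. Im \<tau> \<le> Im \<sigma> \<longrightarrow>
     norm (\<Sum>\<^sub>\<infinity>k\<in>-F. theta_term n c d (of_real a * \<sigma> + of_real b) \<sigma> k) \<le> G * exp (- pi * Im \<sigma> * (M - a\<^sup>2))"
    by (rule theta_tail_bound) (use assms(1) M in auto)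
  then obtain G where G: "\<And>\<sigma> b. Im \<tau> \<le> Im \<sigma> \<Longrightarrow>
     norm (\<Sum>\<^sub>\<infinity>k\<in>-F. theta_term n c d (of_real a * \<sigma> + of_real b) \<sigma> k) \<le> G * exp (- pi * Im \<sigma> * (M - a\<^sup>2))"
    by auto
  have E: "norm (E j) = exp (pi * Im (\<sigma> j) * (m - a\<^sup>2))" for j
    unfolding \<sigma>_def by (rule E)
  have "norm (T j * E j) \<le> G * exp (- (pi * (M - m) * Im (\<sigma> j)))" for j
  proof -
    have "norm (T j * E j) \<le> (G * exp (- pi * Im (\<sigma> j) * (M - a\<^sup>2))) * exp (pi * Im (\<sigma> j) * (m - a\<^sup>2))"
      unfolding norm_mult E T_def using G[OF ge, of j "b j"] by (intro mult_right_mono) auto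
    also have "\<dots> = G * exp (- pi * Im (\<sigma> j) * (M - a\<^sup>2) + pi * Im (\<sigma> j) * (m - a\<^sup>2))"
      unfolding exp_add by simp
    also have "- pi * Im (\<sigma> j) * (M - a\<^sup>2) + pi * Im (\<sigma> j) * (m - a\<^sup>2) = - (pi * (M - m) * Im (\<sigma> j))"
      by (simp add: algebra_simps)
    finally show ?thesis .
  qed
  moreover have "(\<lambda>j. G * exp (- (pi * (M - m) * Im (\<sigma> j)))) \<longlonglongrightarrow> 0"
  proof -
    have "filterlim (\<lambda>j. pi * (M - m) * Im (\<sigma> j)) at_top sequentially"
      using \<open>m < M\<close> by (intro filterlim_tendsto_pos_mult_at_top[OF tendsto_const _ lim]) auto
    hence "(\<lambda>j. exp (- (pi * (M - m) * Im (\<sigma> j)))) \<longlonglongrightarrow> 0"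
      by (intro filterlim_compose[OF exp_at_bot] filterlim_compose[OF filterlim_uminus_at_bot_at_top])
    from tendsto_mult_left[OF this, of G] show ?thesis by simp
  qed
  ultimately have "(\<lambda>j. T j * E j) \<longlonglongrightarrow> 0"
    by (intro Lim_null_comparison[of "\<lambda>j. T j * E j"]) auto
  thus ?thesis unfolding T[symmetric] unfolding \<sigma>_def .
qed

lemma Im_power2_mult_pos: "Im \<tau> > 0 \<Longrightarrow> Im (2 ^ j * \<tau>) > 0"
  by (induction j) (simp_all add: mult.assoc)

lemma half_odd_square_ge:
  assumes "k \<notin> {-1, 0 :: int}"
  shows "9 / 4 \<le> (of_int k + 1 / 2 :: real)\<^sup>2"
proof -
  have "2 \<le> k * (k + 1)"
  proof (cases "k \<ge> 1")
    case True
    thus ?thesis using mult_mono[of 1 k 2 "k + 1"] by simp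
  next
    case False
    hence "k \<le> -2" using assms by auto
    thus ?thesis using mult_mono[of 2 "- k" 1 "- k - 1"] by (simp add: algebra_simps)
  qed
  hence "real_of_int 2 \<le> real_of_int (k * (k + 1))" by (subst of_int_le_iff)
  thus ?thesis by (simp add: power2_eq_square algebra_simps)
qed

text \<open>
  In the next three limits the surviving indices are \<open>0\<close>, respectively \<open>-1\<close> and \<open>0\<close>, the latter
  having equal exponents \<open>(k + 1/2)\<^sup>2 = 1/4\<close>.
\<close>

lemma dtheta4_0_tendsto:
  assumes "Im \<tau> > 0"
  shows "(\<lambda>j. dtheta4 0 0 (2 ^ j * \<tau>)) \<longlonglongrightarrow> 1"
proof -
  have "1 \<le> (of_int k + of_int 0 / 2 + 0 :: real)\<^sup>2" if "k \<notin> {0}" for k :: int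
  proof -
    have "1 \<le> k\<^sup>2" using that by (simp add: int_one_le_iff_zero_less)
    hence "real_of_int 1 \<le> real_of_int (k\<^sup>2)" by (subst of_int_le_iff)
    thus ?thesis by simp
  qed
  from theta_deriv_asymptotics[of \<tau> "{0}" 0 1 0 0 "\<lambda>_. 1" 0 1 "\<lambda>_. 0", OF assms _ _ this]
  have "(\<lambda>j. dtheta4 0 0 (2 ^ j * \<tau>) - 1) \<longlonglongrightarrow> 0"
    by (simp add: dtheta_defs theta_term_def)
  thus ?thesis by (simp add: LIM_zero_iff)
qed

lemma dtheta2_0_tendsto:
  assumes "Im \<tau> > 0"
  shows "(\<lambda>j. dtheta2 0 0 (2 ^ j * \<tau>) * exp (- (of_real pi * \<i> / 4 * (2 ^ j * \<tau>)))) \<longlonglongrightarrow> 2"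
proof -
  define E where "E = (\<lambda>j::nat. exp (- (of_real pi * \<i> / 4 * (2 ^ j * \<tau>))))"
  have E: "norm (E j) = exp (pi * Im (2 ^ j * \<tau>) * (1 / 4 - 0\<^sup>2))" for j
    by (simp add: E_def)
  have "(theta_term 0 1 0 0 (2 ^ j * \<tau>) (-1) + theta_term 0 1 0 0 (2 ^ j * \<tau>) 0) * E j = 2" for j
    by (simp add: theta_term_def E_def distrib_right mult_exp_exp power2_eq_square field_simps)
  moreover from theta_deriv_asymptotics[of \<tau> "{-1, 0}" "1/4" "9/4" 1 0 E 0 0 "\<lambda>_. 0", OF assms _ _ _ E]
  have "(\<lambda>j. (dtheta2 0 0 (2 ^ j * \<tau>) - (theta_term 0 1 0 0 (2 ^ j * \<tau>) (-1) + theta_term 0 1 0 0 (2 ^ j * \<tau>) 0)) * E j) \<longlonglongrightarrow> 0"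
    using half_odd_square_ge by (simp add: dtheta_defs)
  ultimately have "(\<lambda>j. dtheta2 0 0 (2 ^ j * \<tau>) * E j - 2) \<longlonglongrightarrow> 0"
    by (simp add: left_diff_distrib)
  thus ?thesis by (simp add: LIM_zero_iff E_def)
qed

lemma dtheta1_1_0_tendsto:
  assumes "Im \<tau> > 0"
  shows "(\<lambda>j. dtheta1 1 0 (2 ^ j * \<tau>) * exp (- (of_real pi * \<i> / 4 * (2 ^ j * \<tau>)))) \<longlonglongrightarrow> 2 * of_real pi"
proof -
  define E where "E = (\<lambda>j::nat. exp (- (of_real pi * \<i> / 4 * (2 ^ j * \<tau>))))"
  have E: "norm (E j) = exp (pi * Im (2 ^ j * \<tau>) * (1 / 4 - 0\<^sup>2))" for j
    by (simp add: E_def)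
  have ex: "exp (of_real pi * \<i> / 2) = \<i>" "exp (- (of_real pi * \<i> / 2)) = - \<i>"
    using cis_conv_exp[of "pi / 2"] by (simp_all add: exp_minus mult.commute)
  have "(theta_term 1 1 1 0 (2 ^ j * \<tau>) (-1) + theta_term 1 1 1 0 (2 ^ j * \<tau>) 0) * E j = - (2 * of_real pi)" for j
  proof -
    have "theta_term 1 1 1 0 (2 ^ j * \<tau>) (-1) * E j = - (of_real pi * \<i>) * exp (- (of_real pi * \<i> / 2))"
      unfolding theta_term_def E_def mult.assoc mult_exp_exp by (simp add: power2_eq_square field_simps)
    moreover have "theta_term 1 1 1 0 (2 ^ j * \<tau>) 0 * E j = of_real pi * \<i> * exp (of_real pi * \<i> / 2)"
      unfolding theta_term_def E_def mult.assoc mult_exp_exp by (simp add: power2_eq_square field_simps)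
    ultimately show ?thesis by (simp add: ex distrib_right)
  qed
  moreover from theta_deriv_asymptotics[of \<tau> "{-1, 0}" "1/4" "9/4" 1 0 E 1 1 "\<lambda>_. 0", OF assms _ _ _ E]
  have "(\<lambda>j. (- dtheta1 1 0 (2 ^ j * \<tau>) - (theta_term 1 1 1 0 (2 ^ j * \<tau>) (-1) + theta_term 1 1 1 0 (2 ^ j * \<tau>) 0)) * E j) \<longlonglongrightarrow> 0"
    using half_odd_square_ge by (simp add: dtheta_defs)
  ultimately have "(\<lambda>j. - (dtheta1 1 0 (2 ^ j * \<tau>) * E j - 2 * of_real pi)) \<longlonglongrightarrow> 0"
    by (simp add: left_diff_distrib)
  hence "(\<lambda>j. dtheta1 1 0 (2 ^ j * \<tau>) * E j - 2 * of_real pi) \<longlonglongrightarrow> 0"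
    by (subst (asm) tendsto_minus_cancel_left[symmetric]) simp
  thus ?thesis by (simp add: LIM_zero_iff E_def)
qed

text \<open>
  A zero of \<open>\<vartheta>\<^sub>3 \<vartheta>\<^sub>4\<close> at \<open>\<tau>\<close> is, by duplication, a zero of \<open>\<vartheta>\<^sub>4\<close> at \<open>2 \<tau>\<close>, hence at every
  \<open>2\<^sup>j \<tau>\<close>, although \<open>\<vartheta>\<^sub>4\<close> tends to \<open>1\<close> there. The same descent works for \<open>\<vartheta>\<^sub>2\<close>.
\<close>

lemma vartheta_nonzero:
  assumes "Im \<tau> > 0"
  shows "dtheta2 0 0 \<tau> \<noteq> 0" "dtheta3 0 0 \<tau> \<noteq> 0" "dtheta4 0 0 \<tau> \<noteq> 0"
proof -
  have v34: "dtheta3 0 0 \<tau> * dtheta4 0 0 \<tau> \<noteq> 0" if \<tau>: "Im \<tau> > 0" for \<tau>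
  proof
    assume z: "dtheta3 0 0 \<tau> * dtheta4 0 0 \<tau> = 0"
    have "dtheta4 0 0 (2 ^ Suc j * \<tau>) = 0" for j
    proof (induction j)
      case 0
      thus ?case using z dtheta_duplication_0(1)[OF \<tau>] by simp
    next
      case (Suc j)
      thus ?case
        using dtheta_duplication_0(1)[OF Im_power2_mult_pos[OF \<tau>], of "Suc j"] by (simp add: mult.assoc)
    qed
    hence "(\<lambda>j. dtheta4 0 0 (2 ^ Suc j * \<tau>)) \<longlonglongrightarrow> 0" by simp
    moreover have "(\<lambda>j. dtheta4 0 0 (2 ^ Suc j * \<tau>)) \<longlonglongrightarrow> 1"
      using LIMSEQ_Suc[OF dtheta4_0_tendsto[OF \<tau>]] .
    ultimately show False using LIMSEQ_unique by fastforce
  qed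
  from v34[OF assms] show "dtheta3 0 0 \<tau> \<noteq> 0" "dtheta4 0 0 \<tau> \<noteq> 0" by auto
  show "dtheta2 0 0 \<tau> \<noteq> 0"
  proof
    assume z: "dtheta2 0 0 \<tau> = 0"
    have "dtheta2 0 0 (2 ^ j * \<tau>) = 0" for j
    proof (induction j)
      case (Suc j)
      thus ?case
        using dtheta_duplication_0(2)[OF Im_power2_mult_pos[OF assms], of j]
          v34[OF Im_power2_mult_pos[OF assms], of "Suc j"] by (simp add: mult.assoc)
    qed (use z in simp)
    hence "(\<lambda>j::nat. 0 :: complex) \<longlonglongrightarrow> 2" using dtheta2_0_tendsto[OF assms] by simp
    thus False using LIMSEQ_unique[OF _ tendsto_const] by fastforce
  qed
qed

text \<open>
  The quotient of the two sides is invariant under \<open>\<tau> \<mapsto> 2 \<tau>\<close>: differentiate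
  \<open>\<theta>\<^sub>1(z|\<tau>) \<theta>\<^sub>2(z|\<tau>) = \<theta>\<^sub>1(2z|2\<tau>) \<vartheta>\<^sub>4(2\<tau>)\<close> at \<open>0\<close>. So it equals its limit along \<open>2\<^sup>j \<tau>\<close>.
\<close>

theorem jacobi_derivative_formula:
  assumes "Im \<tau> > 0"
  shows "dtheta1 1 0 \<tau> = of_real pi * dtheta2 0 0 \<tau> * dtheta3 0 0 \<tau> * dtheta4 0 0 \<tau>"
proof -
  define J where "J = (\<lambda>\<tau>. dtheta1 1 0 \<tau> / (dtheta2 0 0 \<tau> * (dtheta3 0 0 \<tau> * dtheta4 0 0 \<tau>)))"
  have double: "J (2 * \<tau>) = J \<tau>" if \<tau>: "Im \<tau> > 0" for \<tau>
  proof -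
    have \<tau>2: "Im (2 * \<tau>) > 0" using \<tau> by simp
    have "((\<lambda>z. dtheta1 0 z \<tau> * dtheta2 0 z \<tau>) has_field_derivative dtheta1 1 0 \<tau> * dtheta2 0 0 \<tau>) (at 0)"
      using \<tau> by (auto intro!: derivative_eq_intros)
    moreover have "((\<lambda>z. dtheta1 0 z \<tau> * dtheta2 0 z \<tau>) has_field_derivative
        2 * dtheta1 1 0 (2 * \<tau>) * dtheta4 0 0 (2 * \<tau>)) (at 0)"
      unfolding dtheta_duplication(1)[OF \<tau>] using \<tau>2 by (auto intro!: derivative_eq_intros)
    ultimately have "dtheta1 1 0 \<tau> * dtheta2 0 0 \<tau> = 2 * dtheta1 1 0 (2 * \<tau>) * dtheta4 0 0 (2 * \<tau>)"
      by (rule DERIV_unique)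
    thus ?thesis
      using vartheta_nonzero[OF \<tau>] vartheta_nonzero[OF \<tau>2] dtheta_duplication_0[OF \<tau>]
      unfolding J_def by (simp add: divide_simps) (simp add: power2_eq_square; algebra)
  qed
  have const: "J (2 ^ j * \<tau>) = J \<tau>" for j
    by (induction j) (use double[OF Im_power2_mult_pos[OF assms]] in \<open>simp_all add: mult.assoc\<close>)
  define E where "E = (\<lambda>j::nat. exp (- (of_real pi * \<i> / 4 * (2 ^ j * \<tau>))))"
  have "(\<lambda>j. (dtheta1 1 0 (2 ^ j * \<tau>) * E j) / ((dtheta2 0 0 (2 ^ j * \<tau>) * E j) * (dtheta4 0 0 (2 ^ Suc j * \<tau>))\<^sup>2))
      \<longlonglongrightarrow> (2 * of_real pi) / (2 * 1\<^sup>2)"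
    unfolding E_def
    by (intro tendsto_intros dtheta1_1_0_tendsto dtheta2_0_tendsto LIMSEQ_Suc[OF dtheta4_0_tendsto] assms) auto
  moreover have "(dtheta1 1 0 (2 ^ j * \<tau>) * E j) / ((dtheta2 0 0 (2 ^ j * \<tau>) * E j) * (dtheta4 0 0 (2 ^ Suc j * \<tau>))\<^sup>2)
     = J \<tau>" for j
    using const[of j] dtheta_duplication_0(1)[OF Im_power2_mult_pos[OF assms], of j]
    by (simp add: J_def E_def mult.assoc)
  ultimately have "(\<lambda>j::nat. J \<tau>) \<longlonglongrightarrow> of_real pi" by simp
  hence "J \<tau> = of_real pi" by (simp add: LIMSEQ_const_iff)
  thus ?thesis using vartheta_nonzero[OF assms] by (simp add: J_def field_simps)
qed

section \<open>Zeros of the theta functions\<close>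

lemma dtheta1_zero_double:
  assumes "Im \<tau> > 0" "dtheta1 0 z \<tau> = 0"
  shows "dtheta1 0 (2 ^ j * z) (2 ^ j * \<tau>) = 0"
proof (induction j)
  case (Suc j)
  note \<tau>j = Im_power2_mult_pos[OF assms(1), of j]
  have "Im (2 * (2 ^ j * \<tau>)) > 0" using \<tau>j by simp
  thus ?case
    using Suc dtheta_duplication(1)[OF \<tau>j, of "2 ^ j * z"] vartheta_nonzero(3) by (auto simp: mult.assoc)
qed (use assms in simp)

text \<open>
  Doubling \<open>z = a \<tau> + b\<close> together with \<open>\<tau>\<close> keeps \<open>a\<close>, so a zero would persist for all \<open>2\<^sup>j \<tau>\<close>.
  For \<open>0 < a \<le> 1/2\<close> the exponents \<open>(k + 1/2 + a)\<^sup>2\<close> have the unique minimum \<open>k = -1\<close>, and one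
  dominant term cannot be cancelled by the rest.
\<close>

lemma dtheta1_nonzero_off_axis:
  assumes "Im \<tau> > 0" "0 < a" "a \<le> 1 / 2"
  shows "dtheta1 0 (of_real a * \<tau> + of_real b) \<tau> \<noteq> 0"
proof
  assume z: "dtheta1 0 (of_real a * \<tau> + of_real b) \<tau> = 0"
  define h where "h = (\<lambda>j. theta_term 0 1 1 (of_real a * (2 ^ j * \<tau>) + of_real (2 ^ j * b)) (2 ^ j * \<tau>) (-1))"
  have hE: "norm (inverse (h j)) = exp (pi * Im (2 ^ j * \<tau>) * ((a - 1 / 2)\<^sup>2 - a\<^sup>2))" for j
    unfolding h_def norm_inverse norm_theta_term_affine by (simp add: exp_minus[symmetric] power2_eq_square algebra_simps)
  have h0: "h j \<noteq> 0" for j by (simp add: h_def theta_term_def)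
  have bound: "(a + 1 / 2)\<^sup>2 \<le> (of_int k + of_int 1 / 2 + a)\<^sup>2" if "k \<notin> {-1}" for k :: int
  proof (rule abs_le_square_iff[THEN iffD1])
    have "k \<ge> 0 \<or> k \<le> -2" using that by auto
    thus "\<bar>a + 1 / 2\<bar> \<le> \<bar>of_int k + of_int 1 / 2 + a\<bar>"
    proof
      assume "k \<ge> 0"
      hence "real_of_int k \<ge> 0" by simp
      thus ?thesis using assms by simp
    next
      assume "k \<le> -2"
      hence "real_of_int k \<le> real_of_int (-2)" by (subst of_int_le_iff)
      thus ?thesis using assms by simp
    qed
  qed
  have "(a - 1 / 2)\<^sup>2 < (a + 1 / 2)\<^sup>2" using assms by (simp add: power2_eq_square algebra_simps)
  from theta_deriv_asymptotics[of \<tau> "{-1}" _ _ 1 a "\<lambda>j. inverse (h j)" 0 1 "\<lambda>j. 2 ^ j * b", OF assms(1) _ this bound hE]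
  have "(\<lambda>j. (theta_deriv 0 1 1 (of_real a * (2 ^ j * \<tau>) + of_real (2 ^ j * b)) (2 ^ j * \<tau>) - h j) * inverse (h j)) \<longlonglongrightarrow> 0"
    by (simp add: h_def)
  moreover have "theta_deriv 0 1 1 (of_real a * (2 ^ j * \<tau>) + of_real (2 ^ j * b)) (2 ^ j * \<tau>) = 0" for j
    using dtheta1_zero_double[OF assms(1) z, of j] by (simp add: dtheta1_def algebra_simps)
  ultimately have "(\<lambda>j::nat. - 1 :: complex) \<longlonglongrightarrow> 0" using h0 by simp
  thus False by (simp add: LIMSEQ_const_iff)
qed

text \<open>
  Near a zero of the sine, doubling the angle increases its absolute value; a sequence
  \<open>sin (2\<^sup>j x)\<close> can therefore tend to \<open>0\<close> only by reaching it.
\<close>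

lemma sin_double_tendsto_0_imp:
  fixes x :: real
  assumes "(\<lambda>j. sin (2 ^ j * x)) \<longlonglongrightarrow> 0"
  shows "\<exists>j. sin (2 ^ j * x) = 0"
proof -
  define s where "s = (\<lambda>j. (sin (2 ^ j * x))\<^sup>2)"
  have s: "s \<longlonglongrightarrow> 0" using tendsto_power[OF assms, of 2] by (simp add: s_def)
  hence "eventually (\<lambda>j. s j < 1 / 2) sequentially" by (rule order_tendstoD) simp
  then obtain K where K: "\<And>j. j \<ge> K \<Longrightarrow> s j < 1 / 2" by (auto simp: eventually_sequentially)
  \<comment> \<open>\<open>sin\<^sup>2 (2 x) = 4 sin\<^sup>2 x (1 - sin\<^sup>2 x) \<ge> 2 sin\<^sup>2 x\<close> once \<open>sin\<^sup>2 x \<le> 1/2\<close>\<close>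
  have step: "s j \<le> s (Suc j)" if "j \<ge> K" for j
  proof -
    have "s (Suc j) = 4 * s j * (1 - s j)"
      by (simp add: s_def mult.assoc sin_double cos_squared_eq power_mult_distrib)
    moreover have "s j \<ge> 0" by (simp add: s_def)
    ultimately show ?thesis using K[OF that] mult_left_mono[of "1/4" "1 - s j" "4 * s j"] by simp
  qed
  have "s K \<le> s (i + K)" for i
  proof (induction i)
    case (Suc i)
    thus ?case using step[of "i + K"] by simp
  qed simp
  hence "s K \<le> 0" using LIMSEQ_ignore_initial_segment[OF s, of K] by (intro LIMSEQ_le_const) auto
  thus ?thesis by (auto simp: s_def)
qed

lemma dtheta1_half: "dtheta1 0 (1 / 2) \<tau> = dtheta2 0 0 \<tau>"
  using theta_deriv_0_half_period[of 1 1 0 0 \<tau> 1] theta_deriv_add_even_right[of 0 1 0 1 0 \<tau>]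
  by (simp add: dtheta_defs)

lemma dtheta1_add_int_eq_0_iff:
  "dtheta1 0 (z + of_int n) \<tau> = 0 \<longleftrightarrow> dtheta1 0 z \<tau> = 0"
  using theta_deriv_0_half_period[of 1 1 z 0 \<tau> "2 * n"] theta_deriv_add_even_right[of 0 1 1 n z \<tau>]
  by (simp add: dtheta_defs)

text \<open>
  On the real axis two terms dominate and \<open>\<theta>\<^sub>1(2\<^sup>j b|2\<^sup>j \<tau>)\<close> behaves like a multiple of
  \<open>sin (2\<^sup>j \<pi> b)\<close>. If all these values vanish, then \<open>2\<^sup>j b\<close> is an integer for some \<open>j\<close>. The power
  of two is then removed one factor at a time: if \<open>2 b\<close> is an odd integer, the value at \<open>b\<close> is
  \<open>\<vartheta>\<^sub>2\<close> up to sign, which is nonzero.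
\<close>

lemma dtheta1_zero_real:
  fixes b :: real
  assumes "Im \<tau> > 0" "dtheta1 0 (of_real b) \<tau> = 0"
  shows "b \<in> \<int>"
proof -
  define E where "E = (\<lambda>j::nat. exp (- (of_real pi * \<i> / 4 * (2 ^ j * \<tau>))))"
  have E: "norm (E j) = exp (pi * Im (2 ^ j * \<tau>) * (1 / 4 - 0\<^sup>2))" for j
    by (simp add: E_def)
  define B where "B = (\<lambda>j::nat. complex_of_real (2 ^ j * b))"
  have ex: "exp (of_real pi * \<i> / 2) = \<i>" "exp (- (of_real pi * \<i> / 2)) = - \<i>"
    using cis_conv_exp[of "pi / 2"] by (simp_all add: exp_minus mult.commute)
  \<comment> \<open>the two dominant terms combine into a sine\<close>
  have lead: "(theta_term 0 1 1 (B j) (2 ^ j * \<tau>) (-1) + theta_term 0 1 1 (B j) (2 ^ j * \<tau>) 0) * E j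
      = - of_real (2 * sin (2 ^ j * (pi * b)))" for j
  proof -
    have "theta_term 0 1 1 (B j) (2 ^ j * \<tau>) (-1) * E j = exp (- (of_real pi * \<i> / 2)) * exp (- (\<i> * (of_real pi * B j)))"
      unfolding theta_term_def E_def mult.assoc mult_exp_exp power_0 mult_1_left
      by (rule arg_cong[of _ _ exp]) (simp add: power2_eq_square field_simps)
    moreover have "theta_term 0 1 1 (B j) (2 ^ j * \<tau>) 0 * E j = exp (of_real pi * \<i> / 2) * exp (\<i> * (of_real pi * B j))"
      unfolding theta_term_def E_def mult.assoc mult_exp_exp power_0 mult_1_left
      by (rule arg_cong[of _ _ exp]) (simp add: power2_eq_square field_simps)
    ultimately have "(theta_term 0 1 1 (B j) (2 ^ j * \<tau>) (-1) + theta_term 0 1 1 (B j) (2 ^ j * \<tau>) 0) * E j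
      = - (2 * sin (of_real pi * B j))"
      by (simp only: ex distrib_right) (simp add: sin_exp_eq right_diff_distrib diff_divide_distrib)
    also have "of_real pi * B j = of_real (2 ^ j * (pi * b))" by (simp add: B_def)
    finally show ?thesis unfolding sin_of_real by simp
  qed
  have "theta_deriv 0 1 1 (of_real 0 * (2 ^ j * \<tau>) + B j) (2 ^ j * \<tau>) = 0" for j
    using dtheta1_zero_double[OF assms, of j] by (simp add: dtheta1_def B_def)
  with theta_deriv_asymptotics[of \<tau> "{-1, 0}" "1/4" "9/4" 1 0 E 0 1 "\<lambda>j. 2 ^ j * b", OF assms(1) _ _ _ E]
  have "(\<lambda>j. (0 - (theta_term 0 1 1 (B j) (2 ^ j * \<tau>) (-1) + theta_term 0 1 1 (B j) (2 ^ j * \<tau>) 0)) * E j) \<longlonglongrightarrow> 0"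
    using half_odd_square_ge by (simp add: B_def)
  hence "(\<lambda>j. complex_of_real (2 * sin (2 ^ j * (pi * b)))) \<longlonglongrightarrow> complex_of_real 0"
    unfolding left_diff_distrib lead by simp
  hence "(\<lambda>j. 2 * sin (2 ^ j * (pi * b))) \<longlonglongrightarrow> 0" by (simp only: tendsto_of_real_iff)
  from tendsto_mult_left[OF this, of "1/2"] have "(\<lambda>j. sin (2 ^ j * (pi * b))) \<longlonglongrightarrow> 0" by simp
  then obtain j where "sin (2 ^ j * (pi * b)) = 0" using sin_double_tendsto_0_imp by blast
  then obtain i :: int where "2 ^ j * (pi * b) = of_int i * pi" using sin_zero_iff_int2 by auto
  hence "2 ^ j * b \<in> \<int>" by (simp add: mult_ac)
  with assms show ?thesis
  proof (induction j arbitrary: b \<tau>)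
    case (Suc j)
    have \<tau>2: "Im (2 * \<tau>) > 0" using Suc.prems by simp
    have "dtheta1 0 (of_real (2 * b)) (2 * \<tau>) = 0"
      using dtheta1_zero_double[OF Suc.prems(1,2), of 1] by simp
    moreover have "2 ^ j * (2 * b) \<in> \<int>" using Suc.prems(3) by (simp add: mult_ac)
    ultimately have "2 * b \<in> \<int>" by (rule Suc.IH[OF \<tau>2])
    then obtain i where i: "2 * b = of_int i" by (elim Ints_cases)
    show ?case
    proof (cases "even i")
      case True
      then obtain l where "i = 2 * l" by (elim evenE)
      hence "b = of_int l" using i by simp
      thus ?thesis by simp
    next
      case False
      then obtain l where "i = 2 * l + 1" by (elim oddE)
      hence "b = 1 / 2 + of_int l" using i by simp
      hence "dtheta1 0 (1 / 2) \<tau> = 0"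
        using Suc.prems(2) dtheta1_add_int_eq_0_iff[of "1/2" l \<tau>] by simp
      thus ?thesis using vartheta_nonzero(1)[OF Suc.prems(1)] by (simp add: dtheta1_half)
    qed
  qed simp
qed

text \<open>
  Quasi-periodicity moves \<open>a\<close> into \<open>[-1/2, 1/2]\<close>, and oddness makes it nonnegative.
\<close>

theorem dtheta1_zero_imp_lattice:
  fixes a b :: real
  assumes "Im \<tau> > 0" "dtheta1 0 (of_real a * \<tau> + of_real b) \<tau> = 0"
  shows "a \<in> \<int>" "b \<in> \<int>"
proof -
  define m where "m = round a"
  define a' where "a' = a - of_int m"
  have a': "\<bar>a'\<bar> \<le> 1 / 2" using of_int_round_abs_le[of a] by (simp add: a'_def m_def abs_minus_commute)
  have a: "a = a' + of_int m" by (simp add: a'_def)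
  have eq: "of_real a * \<tau> + of_real b = (of_real a' * \<tau> + of_real b) + of_int (2 * m) / 2 * \<tau> + of_int 0 / 2"
    by (simp add: a algebra_simps)
  have z: "dtheta1 0 (of_real a' * \<tau> + of_real b) \<tau> = 0"
    using assms(2) theta_deriv_0_half_period[of 1 1 "of_real a' * \<tau> + of_real b" "2 * m" \<tau> 0]
    unfolding eq dtheta1_def by (simp add: theta_deriv_add_even_left)
  have "a' = 0"
  proof (rule ccontr)
    assume "a' \<noteq> 0"
    show False
    proof (cases "a' > 0")
      case True
      thus False using z a' dtheta1_nonzero_off_axis[OF assms(1), of a' b] by simp
    next
      case False
      have "dtheta1 0 (of_real (- a') * \<tau> + of_real (- b)) \<tau> = 0"
        using z dtheta_minus(1)[of 0 "of_real a' * \<tau> + of_real b" \<tau>] by simp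
      moreover have "0 < - a'" "- a' \<le> 1 / 2" using False \<open>a' \<noteq> 0\<close> a' by auto
      ultimately show False using dtheta1_nonzero_off_axis[OF assms(1)] by blast
    qed
  qed
  thus "a \<in> \<int>" by (simp add: a)
  from z \<open>a' = 0\<close> show "b \<in> \<int>" by (intro dtheta1_zero_real[OF assms(1)]) simp
qed

text \<open>
  Translation by a half-period takes each of the other three theta functions to \<open>\<theta>\<^sub>1\<close>, up to an
  exponential factor.
\<close>

lemma dtheta_zero_imp_half_lattice:
  fixes a b :: real
  assumes "Im \<tau> > 0" "z = of_real a * \<tau> + of_real b"
    and "dtheta2 0 z \<tau> = 0 \<or> dtheta3 0 z \<tau> = 0 \<or> dtheta4 0 z \<tau> = 0"
  shows "2 * a \<in> \<int> \<and> 2 * b \<in> \<int>"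
proof -
  have shift: "2 * a \<in> \<int> \<and> 2 * b \<in> \<int>" if "theta_deriv 0 1 1 (z + of_int m / 2 * \<tau> + of_int n / 2) \<tau> = 0" for m n
  proof -
    have eq: "z + of_int m / 2 * \<tau> + of_int n / 2
        = of_real (a + of_int m / 2) * \<tau> + of_real (b + of_int n / 2)"
      unfolding assms(2) by (simp add: distrib_right)
    have "a + of_int m / 2 \<in> \<int>" and "b + of_int n / 2 \<in> \<int>"
      using dtheta1_zero_imp_lattice[OF assms(1), of "a + of_int m / 2" "b + of_int n / 2"] that
      unfolding eq[symmetric] dtheta1_def by auto
    hence "2 * (a + of_int m / 2) - of_int m \<in> \<int> \<and> 2 * (b + of_int n / 2) - of_int n \<in> \<int>"
      by (intro conjI Ints_diff Ints_mult Ints_numeral Ints_of_int)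
    thus ?thesis by simp
  qed
  have "theta_deriv 0 1 2 z \<tau> = - dtheta2 0 z \<tau>" "theta_deriv 0 2 2 z \<tau> = dtheta3 0 z \<tau>"
    "theta_deriv 0 2 1 z \<tau> = dtheta4 0 z \<tau>"
    using theta_deriv_add_even_right[of 0 1 0 1 z \<tau>] theta_deriv_add_even_right[of 0 0 0 1 z \<tau>]
      theta_deriv_add_even_left[of 0 0 1 2 z \<tau>] theta_deriv_add_even_left[of 0 0 1 1 z \<tau>]
    by (simp_all add: dtheta_defs)
  with assms(3) show ?thesis
    using shift[of 0 1] shift[of 1 1] shift[of 1 0]
      theta_deriv_0_half_period[of 1 1 z 0 \<tau> 1] theta_deriv_0_half_period[of 1 1 z 1 \<tau> 1]
      theta_deriv_0_half_period[of 1 1 z 1 \<tau> 0]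
    by auto
qed

text \<open>
  The function \<open>F(w) = exp (\<pi> i m w) \<theta>\<^sub>1(w)\<close> satisfies \<open>F(2 z - w) = C F(w)\<close> with a constant \<open>C\<close>.
  As \<open>F(z) \<noteq> 0\<close>, the constant is \<open>1\<close>, so \<open>F\<close> is even about \<open>z\<close> and its derivative there is \<open>0\<close>.
\<close>

lemma dtheta1_half_period_stationary:
  assumes "Im \<tau> > 0" and z: "2 * z = of_int m * \<tau> + of_int n" and nz: "dtheta1 0 z \<tau> \<noteq> 0"
  shows "dtheta1 1 z \<tau> + of_real pi * \<i> * of_int m * dtheta1 0 z \<tau> = 0"
proof -
  define F where "F = (\<lambda>w. exp (of_real pi * \<i> * of_int m * w) * dtheta1 0 w \<tau>)"
  define D where "D = exp (of_real pi * \<i> * of_int m * z) * (dtheta1 1 z \<tau> + of_real pi * \<i> * of_int m * dtheta1 0 z \<tau>)"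
  define C where "C = - exp (of_real pi * \<i> * of_int m * 2 * z - of_real pi * \<i> * (of_int (2 * m))\<^sup>2 / 4 * \<tau>
          - of_real pi * \<i> * of_int m * of_int (1 + 2 * n) + of_real pi * \<i> * of_int ((1 + 2 * m) * n))"
  have C: "F (2 * z - w) = C * F w" for w
  proof -
    have "2 * z - w = - w + of_int (2 * m) / 2 * \<tau> + of_int (2 * n) / 2" using z by simp
    hence "theta_deriv 0 1 1 (2 * z - w) \<tau> = exp (- (of_real pi * \<i> * (of_int (2 * m))\<^sup>2 / 4 * \<tau>)
          - of_real pi * \<i> * of_int (2 * m) * (- w + of_int (1 + 2 * n) / 2))
        * (exp (of_real pi * \<i> * of_int ((1 + 2 * m) * n)) * theta_deriv 0 1 1 (- w) \<tau>)"
      by (simp only: theta_deriv_0_half_period theta_deriv_add_even_right theta_deriv_add_even_left)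
    moreover have "theta_deriv 0 1 1 (- w) \<tau> = dtheta1 0 w \<tau>"
      using dtheta_minus(1)[of 0 w \<tau>] by (simp add: dtheta1_def eq_neg_iff_add_eq_0 neg_eq_iff_add_eq_0 add.commute)
    ultimately have "F (2 * z - w) = - (exp (of_real pi * \<i> * of_int m * (2 * z - w))
        * (exp (- (of_real pi * \<i> * (of_int (2 * m))\<^sup>2 / 4 * \<tau>)
          - of_real pi * \<i> * of_int (2 * m) * (- w + of_int (1 + 2 * n) / 2))
        * exp (of_real pi * \<i> * of_int ((1 + 2 * m) * n)))) * dtheta1 0 w \<tau>"
      by (simp add: F_def dtheta1_def)
    also have "exp (of_real pi * \<i> * of_int m * (2 * z - w))
        * (exp (- (of_real pi * \<i> * (of_int (2 * m))\<^sup>2 / 4 * \<tau>)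
          - of_real pi * \<i> * of_int (2 * m) * (- w + of_int (1 + 2 * n) / 2))
        * exp (of_real pi * \<i> * of_int ((1 + 2 * m) * n)))
      = - C * exp (of_real pi * \<i> * of_int m * w)"
      unfolding C_def minus_minus mult_exp_exp by (rule arg_cong[of _ _ exp]) (simp add: algebra_simps)
    finally show ?thesis by (simp add: F_def mult.assoc)
  qed
  have dF: "(F has_field_derivative D) (at z)"
    unfolding F_def using assms(1) by (auto intro!: derivative_eq_intros simp: D_def algebra_simps)
  have "F z \<noteq> 0" using nz by (simp add: F_def)
  with C[of z] have "C = 1" by simp
  hence "(\<lambda>w. F (2 * z - w)) = F" using C by auto
  moreover have "((\<lambda>w. F (2 * z - w)) has_field_derivative D * (- 1)) (at z)"
    by (rule DERIV_chain2[of F]) (use dF in \<open>auto intro!: derivative_eq_intros\<close>)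
  ultimately have "D = D * (- 1)" using dF DERIV_unique by metis
  thus ?thesis by (simp add: D_def eq_neg_iff_add_eq_0)
qed

section \<open>Differential identities for the theta functions\<close>

text \<open>
  Differentiate \<open>\<theta>\<^sub>1(z + h) \<theta>\<^sub>2(z - h)\<close> in \<open>h\<close> at \<open>0\<close>, where the product formula separates \<open>z\<close>
  from \<open>h\<close>. Up to the factor \<open>\<theta>\<^sub>1\<^sup>2\<close> the left-hand side is the derivative of \<open>\<theta>\<^sub>2 / \<theta>\<^sub>1\<close>.
\<close>

lemma dtheta1_dtheta2_wronskian:
  assumes "Im \<tau> > 0"
  shows "dtheta2 1 z \<tau> * dtheta1 0 z \<tau> - dtheta2 0 z \<tau> * dtheta1 1 z \<tau>
     = - of_real pi * (dtheta2 0 0 \<tau>)\<^sup>2 * dtheta3 0 z \<tau> * dtheta4 0 z \<tau>"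
proof -
  have \<tau>2: "Im (2 * \<tau>) > 0" using assms by simp
  have "((\<lambda>h. dtheta1 0 (z + h) \<tau> * dtheta2 0 (z - h) \<tau>) has_field_derivative
      dtheta1 1 z \<tau> * dtheta2 0 z \<tau> - dtheta1 0 z \<tau> * dtheta2 1 z \<tau>) (at 0)"
    using assms by (auto intro!: derivative_eq_intros)
  moreover have "((\<lambda>h. dtheta1 0 (z + h) \<tau> * dtheta2 0 (z - h) \<tau>) has_field_derivative
      2 * dtheta4 0 (2 * z) (2 * \<tau>) * dtheta1 1 0 (2 * \<tau>)) (at 0)"
    unfolding dtheta1_mult_dtheta2[OF assms] using \<tau>2 by (auto intro!: derivative_eq_intros)
  ultimately have "dtheta1 1 z \<tau> * dtheta2 0 z \<tau> - dtheta1 0 z \<tau> * dtheta2 1 z \<tau>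
      = 2 * dtheta4 0 (2 * z) (2 * \<tau>) * dtheta1 1 0 (2 * \<tau>)"
    by (rule DERIV_unique)
  also have "\<dots> = of_real pi * (2 * dtheta2 0 0 (2 * \<tau>) * dtheta3 0 0 (2 * \<tau>))
      * (dtheta4 0 (2 * z) (2 * \<tau>) * dtheta4 0 0 (2 * \<tau>))"
    unfolding jacobi_derivative_formula[OF \<tau>2] by simp
  also have "\<dots> = of_real pi * (dtheta2 0 0 \<tau>)\<^sup>2 * (dtheta3 0 z \<tau> * dtheta4 0 z \<tau>)"
    unfolding dtheta_duplication_0(2)[OF assms] dtheta_duplication(2)[OF assms] ..
  finally show ?thesis by (simp add: algebra_simps)
qed

lemma dtheta_add_half:
  "dtheta1 n (z + 1 / 2) \<tau> = dtheta2 n z \<tau>" "dtheta2 n (z + 1 / 2) \<tau> = - dtheta1 n z \<tau>"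
proof -
  have "theta_term n a b (z + 1 / 2) \<tau> = theta_term n a (b + 1) z \<tau>" for a b
    by (rule ext) (simp add: theta_term_def add_divide_distrib add_ac)
  thus "dtheta1 n (z + 1 / 2) \<tau> = dtheta2 n z \<tau>" "dtheta2 n (z + 1 / 2) \<tau> = - dtheta1 n z \<tau>"
    using theta_deriv_add_even_right[of n 1 0 1 z \<tau>] by (simp_all add: dtheta_defs theta_deriv_def)
qed

text \<open>
  Second derivative in \<open>h\<close> of \<open>\<theta>\<^sub>1(z + h) \<theta>\<^sub>1(z - h)\<close> at \<open>0\<close>: the product formula expresses it
  through the functions that span the squares \<open>\<theta>\<^sub>1\<^sup>2\<close> and \<open>\<theta>\<^sub>2\<^sup>2\<close>. The coefficient of
  \<open>\<theta>\<^sub>2\<^sup>2\<close> is read off at \<open>z = 0\<close> with Jacobi's derivative formula; \<open>C\<close> need not be known, because it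
  cancels in the equations for \<open>y\<close>. Divided by \<open>\<theta>\<^sub>1\<^sup>2\<close> this is the relation between the Weierstrass
  function and \<open>\<theta>\<^sub>2\<^sup>2 / \<theta>\<^sub>1\<^sup>2\<close>.
\<close>

lemma dtheta1_second_log_derivative:
  assumes "Im \<tau> > 0"
  shows "\<exists>C. \<forall>z. dtheta1 2 z \<tau> * dtheta1 0 z \<tau> - (dtheta1 1 z \<tau>)\<^sup>2
     = C * (dtheta1 0 z \<tau>)\<^sup>2 - of_real pi ^ 2 * (dtheta3 0 0 \<tau>)\<^sup>2 * (dtheta4 0 0 \<tau>)\<^sup>2 * (dtheta2 0 z \<tau>)\<^sup>2"
proof -
  have \<tau>2: "Im (2 * \<tau>) > 0" using assms by simp
  define A B A2 B2 where "A = dtheta3 0 0 (2 * \<tau>)" and "B = dtheta2 0 0 (2 * \<tau>)"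
    and "A2 = dtheta3 2 0 (2 * \<tau>)" and "B2 = dtheta2 2 0 (2 * \<tau>)"
  have nz: "A \<noteq> 0" "B \<noteq> 0" using vartheta_nonzero[OF \<tau>2] by (auto simp: A_def B_def)
  define C where "C = B2 / B + A2 / A"
  define \<kappa> where "\<kappa> = B2 / B - A2 / A"
  have main: "dtheta1 2 z \<tau> * dtheta1 0 z \<tau> - (dtheta1 1 z \<tau>)\<^sup>2 = C * (dtheta1 0 z \<tau>)\<^sup>2 + \<kappa> * (dtheta2 0 z \<tau>)\<^sup>2" for z
  proof -
    define P Q where "P = dtheta3 0 (2 * z) (2 * \<tau>)" and "Q = dtheta2 0 (2 * z) (2 * \<tau>)"
    have prod: "dtheta1 0 (z + h) \<tau> * dtheta1 0 (z - h) \<tau> = P * dtheta2 0 (2 * h) (2 * \<tau>) - Q * dtheta3 0 (2 * h) (2 * \<tau>)" for h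
      using dtheta1_mult_dtheta1[OF assms, of "z + h" "z - h"] by (simp add: P_def Q_def)
    have first: "dtheta1 1 (z + h) \<tau> * dtheta1 0 (z - h) \<tau> - dtheta1 0 (z + h) \<tau> * dtheta1 1 (z - h) \<tau>
        = 2 * P * dtheta2 1 (2 * h) (2 * \<tau>) - 2 * Q * dtheta3 1 (2 * h) (2 * \<tau>)" for h
    proof -
      have "((\<lambda>h. dtheta1 0 (z + h) \<tau> * dtheta1 0 (z - h) \<tau>) has_field_derivative
          dtheta1 1 (z + h) \<tau> * dtheta1 0 (z - h) \<tau> - dtheta1 0 (z + h) \<tau> * dtheta1 1 (z - h) \<tau>) (at h)"
        using assms by (auto intro!: derivative_eq_intros)
      moreover have "((\<lambda>h. dtheta1 0 (z + h) \<tau> * dtheta1 0 (z - h) \<tau>) has_field_derivative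
          2 * P * dtheta2 1 (2 * h) (2 * \<tau>) - 2 * Q * dtheta3 1 (2 * h) (2 * \<tau>)) (at h)"
        unfolding prod using \<tau>2 by (auto intro!: derivative_eq_intros)
      ultimately show ?thesis by (rule DERIV_unique)
    qed
    have "((\<lambda>h. dtheta1 1 (z + h) \<tau> * dtheta1 0 (z - h) \<tau> - dtheta1 0 (z + h) \<tau> * dtheta1 1 (z - h) \<tau>)
        has_field_derivative 2 * (dtheta1 2 z \<tau> * dtheta1 0 z \<tau> - (dtheta1 1 z \<tau>)\<^sup>2)) (at 0)"
      using assms by (auto intro!: derivative_eq_intros simp: power2_eq_square numeral_2_eq_2 algebra_simps)
    moreover have "((\<lambda>h. dtheta1 1 (z + h) \<tau> * dtheta1 0 (z - h) \<tau> - dtheta1 0 (z + h) \<tau> * dtheta1 1 (z - h) \<tau>)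
        has_field_derivative 4 * (P * B2 - Q * A2)) (at 0)"
      unfolding first using \<tau>2
      by (auto intro!: derivative_eq_intros simp: A2_def B2_def numeral_2_eq_2 algebra_simps)
    ultimately have "2 * (dtheta1 2 z \<tau> * dtheta1 0 z \<tau> - (dtheta1 1 z \<tau>)\<^sup>2) = 4 * (P * B2 - Q * A2)"
      by (rule DERIV_unique)
    hence "dtheta1 2 z \<tau> * dtheta1 0 z \<tau> - (dtheta1 1 z \<tau>)\<^sup>2 = 2 * (P * B2 - Q * A2)"
      by algebra
    moreover have sq: "(dtheta1 0 z \<tau>)\<^sup>2 = P * B - Q * A" "(dtheta2 0 z \<tau>)\<^sup>2 = Q * A + P * B"
      using dtheta_mult(1,2)[OF assms, of z z] by (simp_all add: power2_eq_square A_def B_def P_def Q_def)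
    moreover have "C * (P * B - Q * A) + \<kappa> * (Q * A + P * B) = 2 * (P * B2 - Q * A2)"
      unfolding C_def \<kappa>_def using nz by (simp add: field_simps)
    ultimately show ?thesis by (simp only:)
  qed
  \<comment> \<open>at \<open>z = 0\<close> the identity reads \<open>- \<theta>\<^sub>1'(0)\<^sup>2 = \<kappa> \<vartheta>\<^sub>2\<^sup>2\<close>\<close>
  have "\<kappa> = - (of_real pi ^ 2 * (dtheta3 0 0 \<tau>)\<^sup>2 * (dtheta4 0 0 \<tau>)\<^sup>2)"
  proof -
    have "\<kappa> * (dtheta2 0 0 \<tau>)\<^sup>2
        = - (of_real pi ^ 2 * (dtheta3 0 0 \<tau>)\<^sup>2 * (dtheta4 0 0 \<tau>)\<^sup>2) * (dtheta2 0 0 \<tau>)\<^sup>2"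
      using main[of 0] jacobi_derivative_formula[OF assms] by (simp add: power_mult_distrib mult_ac)
    moreover have "(dtheta2 0 0 \<tau>)\<^sup>2 \<noteq> 0" using vartheta_nonzero(1)[OF assms] by simp
    ultimately show ?thesis by (metis mult_right_cancel)
  qed
  with main show ?thesis by (intro exI[of _ C]) simp
qed

text \<open>
  By the heat equation the derivative of \<open>\<vartheta>\<^sub>4 / \<vartheta>\<^sub>3\<close> is governed by
  \<open>\<vartheta>\<^sub>4'' \<vartheta>\<^sub>3 - \<vartheta>\<^sub>4 \<vartheta>\<^sub>3''\<close>, the primes denoting \<open>z\<close>-derivatives at \<open>0\<close>. Both terms are second derivatives
  of \<open>\<theta>\<^sub>3(x) \<theta>\<^sub>4(y) = \<theta>\<^sub>4(u|2\<tau>) \<theta>\<^sub>4(v|2\<tau>) - \<theta>\<^sub>1(u|2\<tau>) \<theta>\<^sub>1(v|2\<tau>)\<close>, where \<open>u = x + y\<close> and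
  \<open>v = x - y\<close>; in their difference only the square of \<open>\<theta>\<^sub>1'(0|2\<tau>)\<close> remains.
\<close>

lemma vartheta_quotient_derivative:
  assumes "Im \<tau> > 0"
  shows "((\<lambda>t. dtheta4 0 0 t / dtheta3 0 0 t) has_field_derivative
     of_real pi / (4 * \<i>) * dtheta2 0 0 \<tau> ^ 4 * (dtheta4 0 0 \<tau> / dtheta3 0 0 \<tau>)) (at \<tau>)"
proof -
  have \<tau>2: "Im (2 * \<tau>) > 0" using assms by simp
  define T0 T2 where "T0 = dtheta4 0 0 (2 * \<tau>)" and "T2 = dtheta4 2 0 (2 * \<tau>)"
  define U where "U = dtheta1 1 0 (2 * \<tau>)"
  have "dtheta3 2 0 \<tau> * dtheta4 0 0 \<tau> = 2 * T2 * T0 - 2 * U\<^sup>2"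
  proof -
    have first: "dtheta3 1 h \<tau> * dtheta4 0 0 \<tau>
      = 2 * dtheta4 1 h (2 * \<tau>) * dtheta4 0 h (2 * \<tau>) - 2 * dtheta1 1 h (2 * \<tau>) * dtheta1 0 h (2 * \<tau>)" for h
    proof -
      have "((\<lambda>h. dtheta3 0 h \<tau> * dtheta4 0 0 \<tau>) has_field_derivative dtheta3 1 h \<tau> * dtheta4 0 0 \<tau>) (at h)"
        using assms by (auto intro!: derivative_eq_intros)
      moreover have "((\<lambda>h. dtheta3 0 h \<tau> * dtheta4 0 0 \<tau>) has_field_derivative
          2 * dtheta4 1 h (2 * \<tau>) * dtheta4 0 h (2 * \<tau>) - 2 * dtheta1 1 h (2 * \<tau>) * dtheta1 0 h (2 * \<tau>)) (at h)"
        unfolding dtheta3_mult_dtheta4[OF assms] using \<tau>2 by (auto intro!: derivative_eq_intros)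
      ultimately show ?thesis by (rule DERIV_unique)
    qed
    have "((\<lambda>h. dtheta3 1 h \<tau> * dtheta4 0 0 \<tau>) has_field_derivative dtheta3 2 0 \<tau> * dtheta4 0 0 \<tau>) (at 0)"
      using assms by (auto intro!: derivative_eq_intros simp: numeral_2_eq_2)
    moreover have "((\<lambda>h. dtheta3 1 h \<tau> * dtheta4 0 0 \<tau>) has_field_derivative 2 * T2 * T0 - 2 * U\<^sup>2) (at 0)"
      unfolding first using \<tau>2
      by (auto intro!: derivative_eq_intros simp: T0_def T2_def U_def numeral_2_eq_2)
    ultimately show ?thesis by (rule DERIV_unique)
  qed
  moreover have "dtheta3 0 0 \<tau> * dtheta4 2 0 \<tau> = 2 * T2 * T0 + 2 * U\<^sup>2"
  proof -
    have prod: "dtheta3 0 0 \<tau> * dtheta4 0 h \<tau> = (dtheta4 0 h (2 * \<tau>))\<^sup>2 + (dtheta1 0 h (2 * \<tau>))\<^sup>2" for h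
      using dtheta3_mult_dtheta4[OF assms, of 0 h] dtheta_minus[of 0 h "2 * \<tau>"] by (simp add: power2_eq_square)
    have first: "dtheta3 0 0 \<tau> * dtheta4 1 h \<tau>
      = 2 * dtheta4 1 h (2 * \<tau>) * dtheta4 0 h (2 * \<tau>) + 2 * dtheta1 1 h (2 * \<tau>) * dtheta1 0 h (2 * \<tau>)" for h
    proof -
      have "((\<lambda>h. dtheta3 0 0 \<tau> * dtheta4 0 h \<tau>) has_field_derivative dtheta3 0 0 \<tau> * dtheta4 1 h \<tau>) (at h)"
        using assms by (auto intro!: derivative_eq_intros)
      moreover have "((\<lambda>h. dtheta3 0 0 \<tau> * dtheta4 0 h \<tau>) has_field_derivative
          2 * dtheta4 1 h (2 * \<tau>) * dtheta4 0 h (2 * \<tau>) + 2 * dtheta1 1 h (2 * \<tau>) * dtheta1 0 h (2 * \<tau>)) (at h)"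
        unfolding prod using \<tau>2 by (auto intro!: derivative_eq_intros)
      ultimately show ?thesis by (rule DERIV_unique)
    qed
    have "((\<lambda>h. dtheta3 0 0 \<tau> * dtheta4 1 h \<tau>) has_field_derivative dtheta3 0 0 \<tau> * dtheta4 2 0 \<tau>) (at 0)"
      using assms by (auto intro!: derivative_eq_intros simp: numeral_2_eq_2)
    moreover have "((\<lambda>h. dtheta3 0 0 \<tau> * dtheta4 1 h \<tau>) has_field_derivative 2 * T2 * T0 + 2 * U\<^sup>2) (at 0)"
      unfolding first using \<tau>2
      by (auto intro!: derivative_eq_intros simp: T0_def T2_def U_def numeral_2_eq_2)
    ultimately show ?thesis by (rule DERIV_unique)
  qed
  moreover have "4 * U\<^sup>2 = of_real pi ^ 2 * dtheta2 0 0 \<tau> ^ 4 * dtheta3 0 0 \<tau> * dtheta4 0 0 \<tau>"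
  proof -
    have "4 * U\<^sup>2 = of_real pi ^ 2 * (2 * dtheta2 0 0 (2 * \<tau>) * dtheta3 0 0 (2 * \<tau>))\<^sup>2 * (dtheta4 0 0 (2 * \<tau>))\<^sup>2"
      unfolding U_def jacobi_derivative_formula[OF \<tau>2] by (simp add: power_mult_distrib)
    also have "\<dots> = of_real pi ^ 2 * ((dtheta2 0 0 \<tau>)\<^sup>2)\<^sup>2 * (dtheta3 0 0 \<tau> * dtheta4 0 0 \<tau>)"
      unfolding dtheta_duplication_0[OF assms] ..
    finally show ?thesis by (simp flip: power_mult)
  qed
  ultimately have W: "dtheta4 2 0 \<tau> * dtheta3 0 0 \<tau> - dtheta4 0 0 \<tau> * dtheta3 2 0 \<tau>
      = of_real pi ^ 2 * dtheta2 0 0 \<tau> ^ 4 * dtheta3 0 0 \<tau> * dtheta4 0 0 \<tau>"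
    by algebra
  have d: "(dtheta3 0 0 has_field_derivative dtheta3 2 0 \<tau> / (4 * of_real pi * \<i>)) (at \<tau>)"
    "(dtheta4 0 0 has_field_derivative dtheta4 2 0 \<tau> / (4 * of_real pi * \<i>)) (at \<tau>)"
    using theta_deriv_has_derivative_line[of 1 \<tau> 0 0 0 0 0 0] theta_deriv_has_derivative_line[of 1 \<tau> 0 0 0 1 0 0]
      assms by (simp_all add: dtheta_defs[abs_def] numeral_2_eq_2)
  have "((\<lambda>t. dtheta4 0 0 t / dtheta3 0 0 t) has_field_derivative
      (dtheta4 2 0 \<tau> / (4 * of_real pi * \<i>) * dtheta3 0 0 \<tau> - dtheta4 0 0 \<tau> * (dtheta3 2 0 \<tau> / (4 * of_real pi * \<i>)))
      / (dtheta3 0 0 \<tau> * dtheta3 0 0 \<tau>)) (at \<tau>)"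
    by (intro DERIV_divide d vartheta_nonzero assms)
  also have "(dtheta4 2 0 \<tau> / (4 * of_real pi * \<i>) * dtheta3 0 0 \<tau> - dtheta4 0 0 \<tau> * (dtheta3 2 0 \<tau> / (4 * of_real pi * \<i>)))
      = (dtheta4 2 0 \<tau> * dtheta3 0 0 \<tau> - dtheta4 0 0 \<tau> * dtheta3 2 0 \<tau>) / (4 * of_real pi * \<i>)"
    by (simp add: diff_divide_distrib)
  finally show ?thesis
    unfolding W using vartheta_nonzero[OF assms] by (simp add: power2_eq_square field_simps)
qed

text \<open>
  Rational identity behind Hitchin's equation. With \<open>r\<close>, \<open>s\<close>, \<open>A\<close>, \<open>B\<close> as in the introduction,
  the two inner brackets on the left are \<open>4 i / \<pi>\<close> times the derivatives of \<open>r\<close> and \<open>s\<close> along the torsion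
  path, grouped by the product rule for \<open>r (s + r)\<close>, and \<open>2 (A\<^sup>2 - B\<^sup>2)\<close> comes from the derivative
  of \<open>B / A\<close>.
\<close>

lemma hitchin_vector_field_algebra:
  fixes A B r s :: complex
  assumes nz: "A \<noteq> 0" "B \<noteq> 0" "r \<noteq> 0" "s \<noteq> 0"
    and y: "y = - (B / A) * (r * (s + r))" and x: "x = B\<^sup>2 / A\<^sup>2"
  shows "2 * (A\<^sup>2 - B\<^sup>2) * y
      - B / A * ((r * (2 * A * B * r\<^sup>2 + A\<^sup>2 + B\<^sup>2) + 2 * ((A * r\<^sup>2 + B) * (B * r\<^sup>2 + A)) / s) * (s + 2 * r)
               + r * (s * (6 * A * B * r\<^sup>2 + A\<^sup>2 + B\<^sup>2) + 2 * r * (2 * A * B * r\<^sup>2 + A\<^sup>2 + B\<^sup>2) + 2 * A * B * r * s\<^sup>2))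
    = - 4 * A ^ 3 * (y * (y - 1) * (y - x) / (A * y + B * r\<^sup>2)) + 2 * A\<^sup>2 * (y - x)\<^sup>2 + 2 * (A\<^sup>2 - B\<^sup>2) * x"
proof -
  have den: "A * y + B * r\<^sup>2 = - (B * r * s)" using nz by (simp add: y power2_eq_square field_simps)
  show ?thesis
    unfolding den unfolding x y using nz by (simp add: divide_simps) algebra
qed

text \<open>
  Here \<open>q\<close>, \<open>q2\<close>, \<open>q3\<close> stand for the first three derivatives of \<open>\<theta>\<^sub>1\<close>, and \<open>r\<close>, \<open>G1\<close>, \<open>G2\<close>,
  \<open>G3\<close> for \<open>\<theta>\<^sub>2\<close> and its first three derivatives, all divided by \<open>\<theta>\<^sub>1\<close>; \<open>r1\<close> is the derivative of
  \<open>r\<close>. The conclusion is \<open>r'' = k r (2 A B r\<^sup>2 + A\<^sup>2 + B\<^sup>2)\<close>, written without \<open>r''\<close> by means of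
  \<open>\<theta>\<^sub>2'' = (r \<theta>\<^sub>1)''\<close>; the next lemma treats the third derivative in the same way. The second
  logarithmic derivatives of \<open>\<theta>\<^sub>1\<close> and \<open>\<theta>\<^sub>2\<close> only determine \<open>r r''\<close>, hence the division by \<open>r\<close>.
\<close>

lemma second_derivative_algebra:
  fixes r r1 q q2 G1 G2 k A B C :: complex
  assumes "r \<noteq> 0" "q2 = q\<^sup>2 - k * A * B * r\<^sup>2 + C" "G1 = r1 + r * q" "G2 * r = G1\<^sup>2 - k * A * B + C * r\<^sup>2"
    "r1\<^sup>2 = k * ((A * r\<^sup>2 + B) * (B * r\<^sup>2 + A))"
  shows "G2 = k * r * (2 * A * B * r\<^sup>2 + A\<^sup>2 + B\<^sup>2) + 2 * r1 * q + r * q2"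
proof -
  have "G2 * r = (k * r * (2 * A * B * r\<^sup>2 + A\<^sup>2 + B\<^sup>2) + 2 * r1 * q + r * q2) * r"
    using assms(2-) by algebra
  with assms(1) show ?thesis by simp
qed

lemma third_derivative_algebra:
  fixes r r1 q q2 q3 G1 G2 G3 k A B C :: complex
  assumes "r \<noteq> 0" "q2 = q\<^sup>2 - k * A * B * r\<^sup>2 + C" "G1 = r1 + r * q"
    "G2 = k * r * (2 * A * B * r\<^sup>2 + A\<^sup>2 + B\<^sup>2) + 2 * r1 * q + r * q2"
    "q3 = q2 * q - 2 * k * A * B * r * G1 + 2 * C * q"
    "G3 * r = G2 * G1 - 2 * k * A * B * q + 2 * C * r * G1"
    "r1\<^sup>2 = k * ((A * r\<^sup>2 + B) * (B * r\<^sup>2 + A))"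
  shows "G3 = k * r1 * (6 * A * B * r\<^sup>2 + A\<^sup>2 + B\<^sup>2) + 3 * (k * r * (2 * A * B * r\<^sup>2 + A\<^sup>2 + B\<^sup>2)) * q
      + 3 * r1 * q2 + r * q3"
proof -
  have "G3 * r = (k * r1 * (6 * A * B * r\<^sup>2 + A\<^sup>2 + B\<^sup>2) + 3 * (k * r * (2 * A * B * r\<^sup>2 + A\<^sup>2 + B\<^sup>2)) * q
      + 3 * r1 * q2 + r * q3) * r"
    using assms(2-) by algebra
  with assms(1) show ?thesis by simp
qed

section \<open>Derivatives along a torsion path\<close>

lemma dtheta_has_derivative_path:
  assumes "Im \<tau> > 0" and c: "c = 2 * of_real pi * \<i> * \<alpha>"
  shows "((\<lambda>t. dtheta1 n (\<alpha> * t + w) t) has_field_derivative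
      (dtheta1 (n + 2) (\<alpha> * \<tau> + w) \<tau> + 2 * c * dtheta1 (n + 1) (\<alpha> * \<tau> + w) \<tau>) / (4 * of_real pi * \<i>)) (at \<tau>)"
    and "((\<lambda>t. dtheta2 n (\<alpha> * t + w) t) has_field_derivative
      (dtheta2 (n + 2) (\<alpha> * \<tau> + w) \<tau> + 2 * c * dtheta2 (n + 1) (\<alpha> * \<tau> + w) \<tau>) / (4 * of_real pi * \<i>)) (at \<tau>)"
proof -
  have *: "((\<lambda>t. theta_deriv n a b (\<alpha> * t + w) t) has_field_derivative
      (theta_deriv (n + 2) a b (\<alpha> * \<tau> + w) \<tau> + 2 * c * theta_deriv (n + 1) a b (\<alpha> * \<tau> + w) \<tau>) / (4 * of_real pi * \<i>)) (at \<tau>)"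
    for a b
    using theta_deriv_has_derivative_line[of 1 \<tau> 0 n a b \<alpha> w] assms(1)
    by (simp add: c add_divide_distrib add.commute)
  show "((\<lambda>t. dtheta2 n (\<alpha> * t + w) t) has_field_derivative
      (dtheta2 (n + 2) (\<alpha> * \<tau> + w) \<tau> + 2 * c * dtheta2 (n + 1) (\<alpha> * \<tau> + w) \<tau>) / (4 * of_real pi * \<i>)) (at \<tau>)"
    unfolding dtheta_defs by (rule *)
  have "- ((theta_deriv (n + 2) 1 1 (\<alpha> * \<tau> + w) \<tau> + 2 * c * theta_deriv (n + 1) 1 1 (\<alpha> * \<tau> + w) \<tau>) / (4 * of_real pi * \<i>))
      = (dtheta1 (n + 2) (\<alpha> * \<tau> + w) \<tau> + 2 * c * dtheta1 (n + 1) (\<alpha> * \<tau> + w) \<tau>) / (4 * of_real pi * \<i>)"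
    unfolding dtheta1_def by (simp only: minus_divide_left) simp
  with DERIV_minus[OF *[of 1 1]]
  show "((\<lambda>t. dtheta1 n (\<alpha> * t + w) t) has_field_derivative
      (dtheta1 (n + 2) (\<alpha> * \<tau> + w) \<tau> + 2 * c * dtheta1 (n + 1) (\<alpha> * \<tau> + w) \<tau>) / (4 * of_real pi * \<i>)) (at \<tau>)"
    by (simp only: dtheta1_def)
qed

text \<open>
  The identity for \<open>\<theta>\<^sub>2\<close> is the one for \<open>\<theta>\<^sub>1\<close> at \<open>z + 1/2\<close>, so the same constant \<open>C\<close> occurs in
  both; the other two are their \<open>z\<close>-derivatives.
\<close>

lemma dtheta1_dtheta2_differential_identities:
  assumes "Im \<tau> > 0"
  defines "A \<equiv> (dtheta3 0 0 \<tau>)\<^sup>2" and "B \<equiv> (dtheta4 0 0 \<tau>)\<^sup>2"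
  shows "\<exists>C. \<forall>z. dtheta1 2 z \<tau> * dtheta1 0 z \<tau> - (dtheta1 1 z \<tau>)\<^sup>2
              = C * (dtheta1 0 z \<tau>)\<^sup>2 - of_real pi ^ 2 * A * B * (dtheta2 0 z \<tau>)\<^sup>2
      \<and> dtheta2 2 z \<tau> * dtheta2 0 z \<tau> - (dtheta2 1 z \<tau>)\<^sup>2
              = C * (dtheta2 0 z \<tau>)\<^sup>2 - of_real pi ^ 2 * A * B * (dtheta1 0 z \<tau>)\<^sup>2
      \<and> dtheta1 3 z \<tau> * dtheta1 0 z \<tau> - dtheta1 2 z \<tau> * dtheta1 1 z \<tau>
              = 2 * C * dtheta1 0 z \<tau> * dtheta1 1 z \<tau> - 2 * of_real pi ^ 2 * A * B * dtheta2 0 z \<tau> * dtheta2 1 z \<tau>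
      \<and> dtheta2 3 z \<tau> * dtheta2 0 z \<tau> - dtheta2 2 z \<tau> * dtheta2 1 z \<tau>
              = 2 * C * dtheta2 0 z \<tau> * dtheta2 1 z \<tau> - 2 * of_real pi ^ 2 * A * B * dtheta1 0 z \<tau> * dtheta1 1 z \<tau>"
proof -
  obtain C where C1: "\<And>z. dtheta1 2 z \<tau> * dtheta1 0 z \<tau> - (dtheta1 1 z \<tau>)\<^sup>2
      = C * (dtheta1 0 z \<tau>)\<^sup>2 - of_real pi ^ 2 * A * B * (dtheta2 0 z \<tau>)\<^sup>2"
    using dtheta1_second_log_derivative[OF assms(1)] unfolding A_def B_def by auto
  have C2: "dtheta2 2 z \<tau> * dtheta2 0 z \<tau> - (dtheta2 1 z \<tau>)\<^sup>2
      = C * (dtheta2 0 z \<tau>)\<^sup>2 - of_real pi ^ 2 * A * B * (dtheta1 0 z \<tau>)\<^sup>2" for z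
    using C1[of "z + 1 / 2"] by (simp only: dtheta_add_half power2_minus)
  have C3: "dtheta1 3 z \<tau> * dtheta1 0 z \<tau> - dtheta1 2 z \<tau> * dtheta1 1 z \<tau>
      = 2 * C * dtheta1 0 z \<tau> * dtheta1 1 z \<tau> - 2 * of_real pi ^ 2 * A * B * dtheta2 0 z \<tau> * dtheta2 1 z \<tau>" for z
  proof -
    have "((\<lambda>z. dtheta1 2 z \<tau> * dtheta1 0 z \<tau> - (dtheta1 1 z \<tau>)\<^sup>2) has_field_derivative
        dtheta1 3 z \<tau> * dtheta1 0 z \<tau> - dtheta1 2 z \<tau> * dtheta1 1 z \<tau>) (at z)"
      using assms(1) by (auto intro!: derivative_eq_intros simp: numeral_2_eq_2 numeral_3_eq_3)
    moreover have "((\<lambda>z. dtheta1 2 z \<tau> * dtheta1 0 z \<tau> - (dtheta1 1 z \<tau>)\<^sup>2) has_field_derivative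
        2 * C * dtheta1 0 z \<tau> * dtheta1 1 z \<tau> - 2 * of_real pi ^ 2 * A * B * dtheta2 0 z \<tau> * dtheta2 1 z \<tau>) (at z)"
      unfolding C1 using assms(1) by (auto intro!: derivative_eq_intros)
    ultimately show ?thesis by (rule DERIV_unique)
  qed
  have C4: "dtheta2 3 z \<tau> * dtheta2 0 z \<tau> - dtheta2 2 z \<tau> * dtheta2 1 z \<tau>
      = 2 * C * dtheta2 0 z \<tau> * dtheta2 1 z \<tau> - 2 * of_real pi ^ 2 * A * B * dtheta1 0 z \<tau> * dtheta1 1 z \<tau>" for z
    using C3[of "z + 1 / 2"] by (simp only: dtheta_add_half) simp
  show ?thesis using C1 C2 C3 C4 by blast
qed

lemma dtheta_ratio_derivatives:
  assumes "Im \<tau> > 0" and f: "dtheta1 0 z \<tau> \<noteq> 0" and g: "dtheta2 0 z \<tau> \<noteq> 0"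
  defines "A \<equiv> (dtheta3 0 0 \<tau>)\<^sup>2" and "B \<equiv> (dtheta4 0 0 \<tau>)\<^sup>2"
    and "f \<equiv> dtheta1 0 z \<tau>" and "r \<equiv> dtheta2 0 z \<tau> / dtheta1 0 z \<tau>"
    and "r1 \<equiv> (dtheta2 1 z \<tau> * dtheta1 0 z \<tau> - dtheta2 0 z \<tau> * dtheta1 1 z \<tau>) / (dtheta1 0 z \<tau>)\<^sup>2"
    and "q \<equiv> dtheta1 1 z \<tau> / dtheta1 0 z \<tau>" and "q2 \<equiv> dtheta1 2 z \<tau> / dtheta1 0 z \<tau>"
    and "q3 \<equiv> dtheta1 3 z \<tau> / dtheta1 0 z \<tau>" and "k \<equiv> of_real pi ^ 2"
  shows "r1\<^sup>2 = k * ((A * r\<^sup>2 + B) * (B * r\<^sup>2 + A))"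
    and "dtheta2 1 z \<tau> / f = r1 + r * q"
    and "dtheta2 2 z \<tau> / f = k * r * (2 * A * B * r\<^sup>2 + A\<^sup>2 + B\<^sup>2) + 2 * r1 * q + r * q2"
    and "dtheta2 3 z \<tau> / f = k * r1 * (6 * A * B * r\<^sup>2 + A\<^sup>2 + B\<^sup>2)
           + 3 * (k * r * (2 * A * B * r\<^sup>2 + A\<^sup>2 + B\<^sup>2)) * q + 3 * r1 * q2 + r * q3"
proof -
  have f0: "f \<noteq> 0" and r0: "r \<noteq> 0" using f g by (auto simp: f_def r_def)
  define G1 G2 G3 where "G1 = dtheta2 1 z \<tau> / f" and "G2 = dtheta2 2 z \<tau> / f" and "G3 = dtheta2 3 z \<tau> / f"
  have subst: "dtheta1 0 z \<tau> = f" "dtheta1 1 z \<tau> = f * q" "dtheta1 2 z \<tau> = f * q2" "dtheta1 3 z \<tau> = f * q3"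
    "dtheta2 0 z \<tau> = f * r" "dtheta2 1 z \<tau> = f * G1" "dtheta2 2 z \<tau> = f * G2" "dtheta2 3 z \<tau> = f * G3"
    using f0 by (simp_all add: f_def q_def q2_def q3_def r_def G1_def G2_def G3_def)
  have r1: "r1 = G1 - r * q"
    unfolding r1_def subst using f0 by (simp add: power2_eq_square field_simps)
  thus G1: "dtheta2 1 z \<tau> / f = r1 + r * q" by (simp add: G1_def)
  show r1_sq: "r1\<^sup>2 = k * ((A * r\<^sup>2 + B) * (B * r\<^sup>2 + A))"
  proof -
    have "r1\<^sup>2 = (- of_real pi * (dtheta2 0 0 \<tau>)\<^sup>2 * dtheta3 0 z \<tau> * dtheta4 0 z \<tau>)\<^sup>2 / (f\<^sup>2)\<^sup>2"
      unfolding r1_def dtheta1_dtheta2_wronskian[OF assms(1)] f_def power_divide ..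
    also have "(- of_real pi * (dtheta2 0 0 \<tau>)\<^sup>2 * dtheta3 0 z \<tau> * dtheta4 0 z \<tau>)\<^sup>2
        = k * (((dtheta2 0 0 \<tau>)\<^sup>2 * (dtheta3 0 z \<tau>)\<^sup>2) * ((dtheta2 0 0 \<tau>)\<^sup>2 * (dtheta4 0 z \<tau>)\<^sup>2))"
      unfolding k_def by algebra
    also have "\<dots> = k * ((A * (f * r)\<^sup>2 + B * f\<^sup>2) * (B * (f * r)\<^sup>2 + A * f\<^sup>2))"
      unfolding dtheta_squares[OF assms(1)] A_def B_def subst ..
    also have "\<dots> = k * ((A * r\<^sup>2 + B) * (B * r\<^sup>2 + A)) * (f\<^sup>2)\<^sup>2" by algebra
    finally show ?thesis using f0 by simp
  qed
  obtain C where C: "f * q2 * f - (f * q)\<^sup>2 = C * f\<^sup>2 - k * A * B * (f * r)\<^sup>2"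
    "f * G2 * (f * r) - (f * G1)\<^sup>2 = C * (f * r)\<^sup>2 - k * A * B * f\<^sup>2"
    "f * q3 * f - f * q2 * (f * q) = 2 * C * f * (f * q) - 2 * k * A * B * (f * r) * (f * G1)"
    "f * G3 * (f * r) - f * G2 * (f * G1) = 2 * C * (f * r) * (f * G1) - 2 * k * A * B * f * (f * q)"
    using dtheta1_dtheta2_differential_identities[OF assms(1)]
    unfolding A_def[symmetric] B_def[symmetric] k_def[symmetric] by (metis subst)
  have cancel: "f\<^sup>2 * X = f\<^sup>2 * Y \<Longrightarrow> X = Y" for X Y using f0 by simp
  have q2: "q2 = q\<^sup>2 - k * A * B * r\<^sup>2 + C" by (rule cancel) (use C(1) in algebra)
  have G2r: "G2 * r = G1\<^sup>2 - k * A * B + C * r\<^sup>2" by (rule cancel) (use C(2) in algebra)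
  have q3: "q3 = q2 * q - 2 * k * A * B * r * G1 + 2 * C * q" by (rule cancel) (use C(3) in algebra)
  have G3r: "G3 * r = G2 * G1 - 2 * k * A * B * q + 2 * C * r * G1" by (rule cancel) (use C(4) in algebra)
  have G1': "G1 = r1 + r * q" using r1 by simp
  note G2 = second_derivative_algebra[OF r0 q2 G1' G2r r1_sq]
  show "dtheta2 2 z \<tau> / f = k * r * (2 * A * B * r\<^sup>2 + A\<^sup>2 + B\<^sup>2) + 2 * r1 * q + r * q2"
    using G2 by (simp only: G2_def)
  show "dtheta2 3 z \<tau> / f = k * r1 * (6 * A * B * r\<^sup>2 + A\<^sup>2 + B\<^sup>2)
           + 3 * (k * r * (2 * A * B * r\<^sup>2 + A\<^sup>2 + B\<^sup>2)) * q + 3 * r1 * q2 + r * q3"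
    using third_derivative_algebra[OF r0 q2 G1' G2 q3 G3r r1_sq] by (simp only: G3_def)
qed

text \<open>The relation \<open>4 \<pi> i D r = r'' + 2 r' p\<close>, with \<open>r''\<close> expressed through \<open>r\<close>.\<close>

lemma dtheta_ratio_has_derivative:
  assumes "Im \<tau> > 0" and z: "z = \<alpha> * \<tau> + w"
    and "dtheta1 0 z \<tau> \<noteq> 0" "dtheta2 0 z \<tau> \<noteq> 0"
  defines "A \<equiv> (dtheta3 0 0 \<tau>)\<^sup>2" and "B \<equiv> (dtheta4 0 0 \<tau>)\<^sup>2"
    and "r \<equiv> dtheta2 0 z \<tau> / dtheta1 0 z \<tau>"
    and "r1 \<equiv> (dtheta2 1 z \<tau> * dtheta1 0 z \<tau> - dtheta2 0 z \<tau> * dtheta1 1 z \<tau>) / (dtheta1 0 z \<tau>)\<^sup>2"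
    and "p \<equiv> (dtheta1 1 z \<tau> + 2 * of_real pi * \<i> * \<alpha> * dtheta1 0 z \<tau>) / dtheta1 0 z \<tau>"
  shows "((\<lambda>t. dtheta2 0 (\<alpha> * t + w) t / dtheta1 0 (\<alpha> * t + w) t) has_field_derivative
     (of_real pi ^ 2 * r * (2 * A * B * r\<^sup>2 + A\<^sup>2 + B\<^sup>2) + 2 * r1 * p) / (4 * of_real pi * \<i>)) (at \<tau>)"
proof -
  define c where "c = 2 * of_real pi * \<i> * \<alpha>"
  define f where "f = dtheta1 0 z \<tau>"
  define e where "e = 4 * of_real pi * \<i>"
  have f0: "f \<noteq> 0" using assms(3) by (simp add: f_def)
  note d = dtheta_has_derivative_path[OF assms(1) c_def, of 0 w, folded z e_def]
  have p: "p = dtheta1 1 z \<tau> / f + c" using f0 by (simp add: p_def c_def f_def add_divide_distrib)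
  define X Y where "X = dtheta2 2 z \<tau> + 2 * c * dtheta2 1 z \<tau>" and "Y = dtheta1 2 z \<tau> + 2 * c * dtheta1 1 z \<tau>"
  have e0: "e \<noteq> 0" by (simp add: e_def)
  have d1: "((\<lambda>t. dtheta1 0 (\<alpha> * t + w) t) has_field_derivative Y / e) (at \<tau>)"
    using d(1) unfolding Y_def by (simp add: numeral_2_eq_2)
  have d2: "((\<lambda>t. dtheta2 0 (\<alpha> * t + w) t) has_field_derivative X / e) (at \<tau>)"
    using d(2) unfolding X_def by (simp add: numeral_2_eq_2)
  have "((\<lambda>t. dtheta2 0 (\<alpha> * t + w) t / dtheta1 0 (\<alpha> * t + w) t) has_field_derivative
      (X / e * f - dtheta2 0 z \<tau> * (Y / e)) / (f * f)) (at \<tau>)"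
    using DERIV_divide[OF d2 d1] assms(3) unfolding z f_def by blast
  moreover have "(X / e * f - dtheta2 0 z \<tau> * (Y / e)) / (f * f) = (X / f - r * (Y / f)) / e"
    using f0 e0 unfolding r_def f_def[symmetric] by (simp add: divide_simps)
  moreover have "X / f = dtheta2 2 z \<tau> / f + 2 * c * (dtheta2 1 z \<tau> / f)"
    by (simp add: X_def add_divide_distrib)
  moreover have "Y / f = dtheta1 2 z \<tau> / f + 2 * c * (dtheta1 1 z \<tau> / f)"
    by (simp add: Y_def add_divide_distrib)
  moreover note dtheta_ratio_derivatives(2,3)[OF assms(1,3,4), folded A_def B_def r_def r1_def f_def]
  ultimately have "((\<lambda>t. dtheta2 0 (\<alpha> * t + w) t / dtheta1 0 (\<alpha> * t + w) t) has_field_derivative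
     (of_real pi ^ 2 * r * (2 * A * B * r\<^sup>2 + A\<^sup>2 + B\<^sup>2) + 2 * r1 * (dtheta1 1 z \<tau> / f) + r * (dtheta1 2 z \<tau> / f)
       + 2 * c * (r1 + r * (dtheta1 1 z \<tau> / f)) - r * (dtheta1 2 z \<tau> / f + 2 * c * (dtheta1 1 z \<tau> / f))) / e) (at \<tau>)"
    by (simp only:)
  moreover have "of_real pi ^ 2 * r * (2 * A * B * r\<^sup>2 + A\<^sup>2 + B\<^sup>2) + 2 * r1 * (dtheta1 1 z \<tau> / f) + r * (dtheta1 2 z \<tau> / f)
       + 2 * c * (r1 + r * (dtheta1 1 z \<tau> / f)) - r * (dtheta1 2 z \<tau> / f + 2 * c * (dtheta1 1 z \<tau> / f))
     = of_real pi ^ 2 * r * (2 * A * B * r\<^sup>2 + A\<^sup>2 + B\<^sup>2) + 2 * r1 * p"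
    unfolding p by algebra
  ultimately show ?thesis unfolding e_def by (simp only:)
qed

text \<open>
  The left-hand side is the quotient rule for \<open>s = W / (\<theta>\<^sub>1 (\<theta>\<^sub>1' + c \<theta>\<^sub>1))\<close>, with
  \<open>W = \<theta>\<^sub>2' \<theta>\<^sub>1 - \<theta>\<^sub>2 \<theta>\<^sub>1'\<close> and \<open>f = \<theta>\<^sub>1\<close>; \<open>X0\<close>, \<open>X1\<close>, \<open>Y0\<close>, \<open>Y1\<close> are the path derivatives of
  \<open>\<theta>\<^sub>2\<close>, \<open>\<theta>\<^sub>2'\<close>, \<open>\<theta>\<^sub>1\<close>, \<open>\<theta>\<^sub>1'\<close> up to the common factor \<open>4 \<pi> i\<close>. Both \<open>c\<close> and \<open>C\<close> disappear.
\<close>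

lemma slope_derivative_algebra:
  fixes f r r1 q q2 q3 c p k A B G1 G2 G3 :: complex
  assumes "f \<noteq> 0" "p \<noteq> 0" and p: "p = q + c" and G1: "G1 = r1 + r * q"
    and G2: "G2 = k * r * (2 * A * B * r\<^sup>2 + A\<^sup>2 + B\<^sup>2) + 2 * r1 * q + r * q2"
    and G3: "G3 = k * r1 * (6 * A * B * r\<^sup>2 + A\<^sup>2 + B\<^sup>2)
           + 3 * (k * r * (2 * A * B * r\<^sup>2 + A\<^sup>2 + B\<^sup>2)) * q + 3 * r1 * q2 + r * q3"
    and q2: "q2 = q\<^sup>2 - k * A * B * r\<^sup>2 + C" and q3: "q3 = q2 * q - 2 * k * A * B * r * G1 + 2 * C * q"
    and s: "s = r1 / p"
    and X0: "X0 = f * (G2 + 2 * c * G1)" and X1: "X1 = f * (G3 + 2 * c * G2)"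
    and Y0: "Y0 = f * (q2 + 2 * c * q)" and Y1: "Y1 = f * (q3 + 2 * c * q2)"
  shows "((X1 * f + (f * G1) * Y0 - (X0 * (f * q) + (f * r) * Y1)) * (f * (f * p))
      - (f\<^sup>2 * r1) * (Y0 * (f * p) + f * (Y1 + c * Y0))) / ((f * (f * p)) * (f * (f * p)))
    = k * (s * (6 * A * B * r\<^sup>2 + A\<^sup>2 + B\<^sup>2) + 2 * r * (2 * A * B * r\<^sup>2 + A\<^sup>2 + B\<^sup>2) + 2 * A * B * r * s\<^sup>2)"
proof -
  have sp: "s * p = r1" using assms by simp
  define L where "L = (G3 + 2 * c * G2 + G1 * (q2 + 2 * c * q) - ((G2 + 2 * c * G1) * q + r * (q3 + 2 * c * q2))) * p
      - r1 * ((q2 + 2 * c * q) * p + (q3 + 2 * c * q2 + c * (q2 + 2 * c * q)))"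
  have "L = k * (r1 * p * (6 * A * B * r\<^sup>2 + A\<^sup>2 + B\<^sup>2) + 2 * r * (2 * A * B * r\<^sup>2 + A\<^sup>2 + B\<^sup>2) * p\<^sup>2 + 2 * A * B * r * r1\<^sup>2)"
    unfolding L_def G3 G2 q3 q2 G1 p by algebra
  also have "\<dots> = k * (s * (6 * A * B * r\<^sup>2 + A\<^sup>2 + B\<^sup>2) + 2 * r * (2 * A * B * r\<^sup>2 + A\<^sup>2 + B\<^sup>2) + 2 * A * B * r * s\<^sup>2) * p\<^sup>2"
    unfolding sp[symmetric] by algebra
  finally have L: "L = \<dots>" .
  have "(X1 * f + (f * G1) * Y0 - (X0 * (f * q) + (f * r) * Y1)) * (f * (f * p))
      - (f\<^sup>2 * r1) * (Y0 * (f * p) + f * (Y1 + c * Y0)) = L * f ^ 4"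
    unfolding X0 X1 Y0 Y1 L_def by algebra
  also have "\<dots> = k * (s * (6 * A * B * r\<^sup>2 + A\<^sup>2 + B\<^sup>2) + 2 * r * (2 * A * B * r\<^sup>2 + A\<^sup>2 + B\<^sup>2) + 2 * A * B * r * s\<^sup>2)
      * ((f * (f * p)) * (f * (f * p)))"
    unfolding L by algebra
  finally show ?thesis using assms(1,2) by simp
qed

text \<open>
  The function \<open>s = r' / p\<close> is the part of Hitchin's solution that involves
  \<open>\<theta>\<^sub>1' + 2 \<pi> i \<alpha> \<theta>\<^sub>1\<close>. Its derivative is again polynomial in \<open>r\<close> and \<open>s\<close>, since the terms with
  \<open>p'\<close> cancel and \<open>p''\<close> is a multiple of \<open>r r'\<close>.
\<close>

lemma slope_has_derivative:
  assumes "Im \<tau> > 0" and z: "z = \<alpha> * \<tau> + w" and c: "c = 2 * of_real pi * \<i> * \<alpha>"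
    and f: "dtheta1 0 z \<tau> \<noteq> 0" and g: "dtheta2 0 z \<tau> \<noteq> 0"
    and S: "dtheta1 1 z \<tau> + c * dtheta1 0 z \<tau> \<noteq> 0"
  defines "A \<equiv> (dtheta3 0 0 \<tau>)\<^sup>2" and "B \<equiv> (dtheta4 0 0 \<tau>)\<^sup>2"
    and "r \<equiv> dtheta2 0 z \<tau> / dtheta1 0 z \<tau>"
    and "s \<equiv> (dtheta2 1 z \<tau> * dtheta1 0 z \<tau> - dtheta2 0 z \<tau> * dtheta1 1 z \<tau>)
              / (dtheta1 0 z \<tau> * (dtheta1 1 z \<tau> + c * dtheta1 0 z \<tau>))"
  shows "((\<lambda>t. (dtheta2 1 (\<alpha> * t + w) t * dtheta1 0 (\<alpha> * t + w) t - dtheta2 0 (\<alpha> * t + w) t * dtheta1 1 (\<alpha> * t + w) t)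
              / (dtheta1 0 (\<alpha> * t + w) t * (dtheta1 1 (\<alpha> * t + w) t + c * dtheta1 0 (\<alpha> * t + w) t)))
     has_field_derivative
       of_real pi ^ 2 * (s * (6 * A * B * r\<^sup>2 + A\<^sup>2 + B\<^sup>2) + 2 * r * (2 * A * B * r\<^sup>2 + A\<^sup>2 + B\<^sup>2) + 2 * A * B * r * s\<^sup>2)
         / (4 * of_real pi * \<i>)) (at \<tau>)"
proof -
  define e where "e = 4 * of_real pi * \<i>"
  define F where "F = dtheta1 0 z \<tau>"
  define q q2 q3 G1 G2 G3 where "q = dtheta1 1 z \<tau> / F" and "q2 = dtheta1 2 z \<tau> / F" and "q3 = dtheta1 3 z \<tau> / F"
    and "G1 = dtheta2 1 z \<tau> / F" and "G2 = dtheta2 2 z \<tau> / F" and "G3 = dtheta2 3 z \<tau> / F"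
  define p where "p = q + c"
  define r1 where "r1 = (dtheta2 1 z \<tau> * dtheta1 0 z \<tau> - dtheta2 0 z \<tau> * dtheta1 1 z \<tau>) / (dtheta1 0 z \<tau>)\<^sup>2"
  define k where "k = (of_real pi :: complex) ^ 2"
  define X0 X1 Y0 Y1 where "X0 = F * (G2 + 2 * c * G1)" and "X1 = F * (G3 + 2 * c * G2)"
    and "Y0 = F * (q2 + 2 * c * q)" and "Y1 = F * (q3 + 2 * c * q2)"
  have F0: "F \<noteq> 0" using f by (simp add: F_def)
  have subst: "dtheta1 0 z \<tau> = F" "dtheta1 1 z \<tau> = F * q" "dtheta1 2 z \<tau> = F * q2" "dtheta1 3 z \<tau> = F * q3"
    "dtheta2 0 z \<tau> = F * r" "dtheta2 1 z \<tau> = F * G1" "dtheta2 2 z \<tau> = F * G2" "dtheta2 3 z \<tau> = F * G3"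
    using F0 F_def[symmetric] unfolding q_def q2_def q3_def r_def G1_def G2_def G3_def by simp_all
  have Sp: "dtheta1 1 z \<tau> + c * dtheta1 0 z \<tau> = F * p" unfolding subst p_def by (simp add: algebra_simps)
  have p0: "p \<noteq> 0" using S unfolding Sp by auto
  note G = dtheta_ratio_derivatives(2-4)[OF assms(1) f g, folded A_def B_def r_def r1_def F_def,
      folded q_def q2_def q3_def G1_def G2_def G3_def k_def]
  have W: "dtheta2 1 z \<tau> * dtheta1 0 z \<tau> - dtheta2 0 z \<tau> * dtheta1 1 z \<tau> = F\<^sup>2 * r1"
    unfolding r1_def using F0 by (simp add: F_def)
  have s: "s = r1 / p"
    unfolding s_def W unfolding Sp unfolding subst using F0 by (simp add: power2_eq_square)
  obtain C where C: "F * q2 * F - (F * q)\<^sup>2 = C * F\<^sup>2 - k * A * B * (F * r)\<^sup>2"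
    "F * q3 * F - F * q2 * (F * q) = 2 * C * F * (F * q) - 2 * k * A * B * (F * r) * (F * G1)"
    using dtheta1_dtheta2_differential_identities[OF assms(1)]
    unfolding A_def[symmetric] B_def[symmetric] k_def[symmetric] by (metis subst)
  have cancel: "F\<^sup>2 * X = F\<^sup>2 * Y \<Longrightarrow> X = Y" for X Y using F0 by simp
  have q2: "q2 = q\<^sup>2 - k * A * B * r\<^sup>2 + C" by (rule cancel) (use C(1) in algebra)
  have q3: "q3 = q2 * q - 2 * k * A * B * r * G1 + 2 * C * q" by (rule cancel) (use C(2) in algebra)
  have path: "dtheta1 (n + 2) z \<tau> = F * a \<Longrightarrow> dtheta1 (n + 1) z \<tau> = F * b \<Longrightarrow>
      ((\<lambda>t. dtheta1 n (\<alpha> * t + w) t) has_field_derivative (F * (a + 2 * c * b)) / e) (at \<tau>)"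
    "dtheta2 (n + 2) z \<tau> = F * a \<Longrightarrow> dtheta2 (n + 1) z \<tau> = F * b \<Longrightarrow>
      ((\<lambda>t. dtheta2 n (\<alpha> * t + w) t) has_field_derivative (F * (a + 2 * c * b)) / e) (at \<tau>)" for n a b
    using dtheta_has_derivative_path[OF assms(1) c, of n w] unfolding z[symmetric] e_def[symmetric]
    by (simp_all add: algebra_simps)
  have d: "((\<lambda>t. dtheta1 0 (\<alpha> * t + w) t) has_field_derivative Y0 / e) (at \<tau>)"
    "((\<lambda>t. dtheta1 1 (\<alpha> * t + w) t) has_field_derivative Y1 / e) (at \<tau>)"
    "((\<lambda>t. dtheta2 0 (\<alpha> * t + w) t) has_field_derivative X0 / e) (at \<tau>)"
    "((\<lambda>t. dtheta2 1 (\<alpha> * t + w) t) has_field_derivative X1 / e) (at \<tau>)"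
    unfolding X0_def X1_def Y0_def Y1_def
    using path(1)[of 0 q2 q] path(1)[of 1 q3 q2] path(2)[of 0 G2 G1] path(2)[of 1 G3 G2] subst
    by (simp_all add: numeral_2_eq_2 numeral_3_eq_3)
  define DW where "DW = X1 / e * dtheta1 0 z \<tau> + dtheta2 1 z \<tau> * (Y0 / e)
      - (X0 / e * dtheta1 1 z \<tau> + dtheta2 0 z \<tau> * (Y1 / e))"
  define DfS where "DfS = Y0 / e * (dtheta1 1 z \<tau> + c * dtheta1 0 z \<tau>) + dtheta1 0 z \<tau> * (Y1 / e + c * (Y0 / e))"
  have dW: "((\<lambda>t. dtheta2 1 (\<alpha> * t + w) t * dtheta1 0 (\<alpha> * t + w) t - dtheta2 0 (\<alpha> * t + w) t * dtheta1 1 (\<alpha> * t + w) t)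
      has_field_derivative DW) (at \<tau>)"
    unfolding DW_def z by (rule derivative_eq_intros d refl | simp add: algebra_simps)+
  have dfS: "((\<lambda>t. dtheta1 0 (\<alpha> * t + w) t * (dtheta1 1 (\<alpha> * t + w) t + c * dtheta1 0 (\<alpha> * t + w) t))
      has_field_derivative DfS) (at \<tau>)"
    unfolding DfS_def z by (rule derivative_eq_intros d refl | simp add: algebra_simps)+
  have fS: "dtheta1 0 z \<tau> * (dtheta1 1 z \<tau> + c * dtheta1 0 z \<tau>) = F * (F * p)"
    unfolding Sp unfolding subst ..
  have quot: "((\<lambda>t. (dtheta2 1 (\<alpha> * t + w) t * dtheta1 0 (\<alpha> * t + w) t - dtheta2 0 (\<alpha> * t + w) t * dtheta1 1 (\<alpha> * t + w) t)
              / (dtheta1 0 (\<alpha> * t + w) t * (dtheta1 1 (\<alpha> * t + w) t + c * dtheta1 0 (\<alpha> * t + w) t)))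
     has_field_derivative (DW * (F * (F * p)) - F\<^sup>2 * r1 * DfS) / ((F * (F * p)) * (F * (F * p)))) (at \<tau>)"
    using DERIV_divide[OF dW dfS, folded z, unfolded W fS] F0 p0 by simp
  have DW: "DW = (X1 * F + (F * G1) * Y0 - (X0 * (F * q) + (F * r) * Y1)) / e"
    unfolding DW_def subst by (simp add: add_divide_distrib diff_divide_distrib)
  have DfS: "DfS = (Y0 * (F * p) + F * (Y1 + c * Y0)) / e"
    unfolding DfS_def Sp unfolding subst by (simp add: add_divide_distrib distrib_left)
  have "(DW * (F * (F * p)) - F\<^sup>2 * r1 * DfS) / ((F * (F * p)) * (F * (F * p)))
     = ((X1 * F + (F * G1) * Y0 - (X0 * (F * q) + (F * r) * Y1)) * (F * (F * p))
      - (F\<^sup>2 * r1) * (Y0 * (F * p) + F * (Y1 + c * Y0))) / ((F * (F * p)) * (F * (F * p))) / e"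
    unfolding DW DfS by (simp only: times_divide_eq_left times_divide_eq_right diff_divide_distrib[symmetric] divide_divide_eq_left mult.commute[of e])
  also have "\<dots> = k * (s * (6 * A * B * r\<^sup>2 + A\<^sup>2 + B\<^sup>2) + 2 * r * (2 * A * B * r\<^sup>2 + A\<^sup>2 + B\<^sup>2) + 2 * A * B * r * s\<^sup>2) / e"
    by (subst slope_derivative_algebra[OF F0 p0 p_def G q2 q3 s X0_def X1_def Y0_def Y1_def]) (rule refl)
  finally show ?thesis using quot unfolding k_def e_def by (simp only:)
qed

section \<open>The differentials of Picard's and Hitchin's solutions\<close>

text \<open>Here \<open>P\<close> stands for \<open>\<pi>\<close>, \<open>R\<close> for \<open>\<vartheta>\<^sub>4 / \<vartheta>\<^sub>3\<close> and \<open>X\<close> for the product \<open>r' p\<close>.\<close>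

lemma picard_vector_field_algebra:
  fixes A B R r X P y :: complex
  assumes "A \<noteq> 0" "P \<noteq> 0" "r \<noteq> 0" and B: "B = R\<^sup>2 * A" and y: "y = - (R * r)\<^sup>2"
  shows "- (2 * (R * r) * (P / (4 * \<i>) * (A\<^sup>2 - B\<^sup>2) * R * r
            + R * ((P\<^sup>2 * r * (2 * A * B * r\<^sup>2 + A\<^sup>2 + B\<^sup>2) + 2 * X) / (4 * P * \<i>))))
       = - (\<i> * X) / (P * r) * y + P * \<i> * A\<^sup>2 * y * (y - 1)"
proof -
  have "P / (4 * \<i>) = - \<i> * P / 4" by (simp add: field_simps)
  moreover have "(P\<^sup>2 * r * (2 * A * B * r\<^sup>2 + A\<^sup>2 + B\<^sup>2) + 2 * X) / (4 * P * \<i>)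
      = - \<i> * (P * r * (2 * A * B * r\<^sup>2 + A\<^sup>2 + B\<^sup>2) + 2 * X / P) / 4"
    using assms(2) by (simp add: field_simps power2_eq_square)
  moreover have "- (\<i> * X) / (P * r) * y = \<i> * (X / P) * (R\<^sup>2 * r)"
    using assms(2,3) by (simp add: y field_simps power2_eq_square)
  moreover have "2 * X / P = 2 * (X / P)" by simp
  ultimately show ?thesis unfolding y B by algebra
qed

lemma theta1_shifted_eq:
  assumes "Im \<tau> > 0"
  shows "theta1_shifted \<nu> \<mu> N \<tau> = dtheta1 1 (torsion_point \<nu> \<mu> N \<tau>) \<tau>
     + 2 * of_real pi * \<i> * (of_int \<nu> / (2 * of_int N)) * dtheta1 0 (torsion_point \<nu> \<mu> N \<tau>) \<tau>"
proof -
  have "theta1_prime z \<tau> = dtheta1 1 z \<tau>" for z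
    unfolding theta1_prime_def theta_eq_dtheta_0
    by (rule DERIV_imp_deriv) (use assms in \<open>auto intro!: derivative_eq_intros\<close>)
  thus ?thesis by (simp add: theta1_shifted_def theta_eq_dtheta_0)
qed

text \<open>
  A zero of \<open>\<theta>\<^sub>2\<close>, \<open>\<theta>\<^sub>3\<close> or \<open>\<theta>\<^sub>4\<close> at the torsion point makes it a half-period
  \<open>(m \<tau> + n) / 2\<close> with \<open>m = \<nu> / N\<close>, where \<open>theta1_shifted\<close> vanishes by symmetry.
\<close>

lemma theta1_shifted_nonzero_imp_dtheta_nonzero:
  assumes "Im \<tau> > 0" and z: "z = torsion_point \<nu> \<mu> N \<tau>"
    and "dtheta1 0 z \<tau> \<noteq> 0" "theta1_shifted \<nu> \<mu> N \<tau> \<noteq> 0"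
  shows "dtheta2 0 z \<tau> \<noteq> 0 \<and> dtheta3 0 z \<tau> \<noteq> 0 \<and> dtheta4 0 z \<tau> \<noteq> 0"
proof (rule ccontr)
  assume zero: "\<not> ?thesis"
  define a b :: real where "a = of_int \<nu> / (2 * of_int N)" and "b = of_int \<mu> / (2 * of_int N)"
  have zab: "z = of_real a * \<tau> + of_real b" by (simp add: z torsion_point_def a_def b_def)
  have "2 * a \<in> \<int>" "2 * b \<in> \<int>"
    using dtheta_zero_imp_half_lattice[OF assms(1) zab] zero by blast+
  then obtain m n where mn: "2 * a = of_int m" "2 * b = of_int n" by (auto elim!: Ints_cases)
  have ab: "a = of_int m / 2" "b = of_int n / 2" using mn by simp_all
  have "2 * z = of_int m * \<tau> + of_int n" unfolding zab ab by (simp add: algebra_simps)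
  from dtheta1_half_period_stationary[OF assms(1) this assms(3)]
  have stat: "dtheta1 1 z \<tau> + of_real pi * \<i> * of_int m * dtheta1 0 z \<tau> = 0" .
  have "(of_int m :: complex) = 2 * of_real a" unfolding ab by simp
  also have "\<dots> = 2 * (of_int \<nu> / (2 * of_int N))" by (simp add: a_def)
  finally have "theta1_shifted \<nu> \<mu> N \<tau> = dtheta1 1 z \<tau> + of_real pi * \<i> * of_int m * dtheta1 0 z \<tau>"
    unfolding theta1_shifted_eq[OF assms(1)] z by simp
  with stat assms(4) show False by simp
qed

text \<open>
  Where \<open>\<theta>\<^sub>2\<close> vanishes, \<open>y\<close> has a double zero, so both sides are \<open>0\<close>, the quotient by \<open>\<theta>\<^sub>2\<close> on the
  right being \<open>0\<close> by convention.
\<close>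

lemma picard_y_has_derivative:
  assumes "Im \<tau> > 0" and z: "z = torsion_point \<nu> \<mu> N \<tau>" and f: "dtheta1 0 z \<tau> \<noteq> 0"
    and y: "y = picard_y \<nu> \<mu> N \<tau>"
  shows "(picard_y \<nu> \<mu> N has_field_derivative
    \<i> * (dtheta2 0 0 \<tau>)\<^sup>2 * theta1_shifted \<nu> \<mu> N \<tau> * (dtheta3 0 z \<tau> * dtheta4 0 z \<tau> / (dtheta2 0 z \<tau> * (dtheta1 0 z \<tau>)\<^sup>2)) * y
      + of_real pi * \<i> * dtheta3 0 0 \<tau> ^ 4 * y * (y - 1)) (at \<tau>)"
proof -
  define \<alpha> w :: complex where "\<alpha> = of_int \<nu> / (2 * of_int N)" and "w = of_int \<mu> / (2 * of_int N)"
  have z': "z = \<alpha> * \<tau> + w" by (simp add: z torsion_point_def \<alpha>_def w_def)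
  define R where "R = (\<lambda>t. dtheta4 0 0 t / dtheta3 0 0 t)"
  define r where "r = (\<lambda>t. dtheta2 0 (\<alpha> * t + w) t / dtheta1 0 (\<alpha> * t + w) t)"
  have pic: "picard_y \<nu> \<mu> N = (\<lambda>t. - (R t * r t)\<^sup>2)"
    by (rule ext) (simp add: picard_y_def Let_def vartheta3_def vartheta4_def theta_eq_dtheta_0
        torsion_point_def R_def r_def \<alpha>_def w_def power_mult_distrib power_divide)
  define A B V where "A = (dtheta3 0 0 \<tau>)\<^sup>2" and "B = (dtheta4 0 0 \<tau>)\<^sup>2" and "V = dtheta2 0 0 \<tau> ^ 4"
  note nz = vartheta_nonzero[OF assms(1)]
  have A0: "A \<noteq> 0" using nz by (simp add: A_def)
  have sq: "A\<^sup>2 = dtheta3 0 0 \<tau> ^ 4" "B\<^sup>2 = dtheta4 0 0 \<tau> ^ 4"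
    by (simp_all add: A_def B_def flip: power_mult)
  have V: "V = A\<^sup>2 - B\<^sup>2" using jacobi_quartic[OF assms(1)] by (simp add: V_def sq)
  have dR: "(R has_field_derivative of_real pi / (4 * \<i>) * V * R \<tau>) (at \<tau>)"
    unfolding R_def V_def by (rule vartheta_quotient_derivative[OF assms(1)])
  have dy: "(picard_y \<nu> \<mu> N has_field_derivative
      - (2 * (R \<tau> * r \<tau>) * (of_real pi / (4 * \<i>) * V * R \<tau> * r \<tau> + R \<tau> * D))) (at \<tau>)"
    if "(r has_field_derivative D) (at \<tau>)" for D
    unfolding pic by (rule derivative_eq_intros dR that refl | simp add: algebra_simps)+
  have rz: "r \<tau> = dtheta2 0 z \<tau> / dtheta1 0 z \<tau>" by (simp add: r_def z')
  show ?thesis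
  proof (cases "dtheta2 0 z \<tau> = 0")
    case True
    hence r0: "r \<tau> = 0" by (simp add: rz)
    have "\<exists>D. (r has_field_derivative D) (at \<tau>)"
      unfolding r_def using f DERIV_divide[OF dtheta_has_derivative_path(2,1)[OF assms(1) refl, of 0 \<alpha> w]] z' by blast
    with dy have "(picard_y \<nu> \<mu> N has_field_derivative 0) (at \<tau>)" by (auto simp: r0)
    moreover have "y = 0" by (simp add: y pic r0)
    ultimately show ?thesis by simp
  next
    case False
    define r1 where "r1 = (dtheta2 1 z \<tau> * dtheta1 0 z \<tau> - dtheta2 0 z \<tau> * dtheta1 1 z \<tau>) / (dtheta1 0 z \<tau>)\<^sup>2"
    define p where "p = (dtheta1 1 z \<tau> + 2 * of_real pi * \<i> * \<alpha> * dtheta1 0 z \<tau>) / dtheta1 0 z \<tau>"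
    have "(r has_field_derivative (of_real pi ^ 2 * r \<tau> * (2 * A * B * (r \<tau>)\<^sup>2 + A\<^sup>2 + B\<^sup>2) + 2 * (r1 * p)) / (4 * of_real pi * \<i>)) (at \<tau>)"
      using dtheta_ratio_has_derivative[OF assms(1) z' f False]
      unfolding r_def[symmetric] rz[symmetric] A_def[symmetric] B_def[symmetric] r1_def[symmetric] p_def[symmetric]
      by (simp only: mult.assoc)
    from dy[OF this]
    have "(picard_y \<nu> \<mu> N has_field_derivative
        - (2 * (R \<tau> * r \<tau>) * (of_real pi / (4 * \<i>) * (A\<^sup>2 - B\<^sup>2) * R \<tau> * r \<tau>
          + R \<tau> * ((of_real pi ^ 2 * r \<tau> * (2 * A * B * (r \<tau>)\<^sup>2 + A\<^sup>2 + B\<^sup>2) + 2 * (r1 * p)) / (4 * of_real pi * \<i>))))) (at \<tau>)"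
      by (simp only: V)
    moreover have "- (2 * (R \<tau> * r \<tau>) * (of_real pi / (4 * \<i>) * (A\<^sup>2 - B\<^sup>2) * R \<tau> * r \<tau>
          + R \<tau> * ((of_real pi ^ 2 * r \<tau> * (2 * A * B * (r \<tau>)\<^sup>2 + A\<^sup>2 + B\<^sup>2) + 2 * (r1 * p)) / (4 * of_real pi * \<i>))))
        = - (\<i> * (r1 * p)) / (of_real pi * r \<tau>) * y + of_real pi * \<i> * A\<^sup>2 * y * (y - 1)"
    proof (rule picard_vector_field_algebra[OF A0])
      show "B = (R \<tau>)\<^sup>2 * A" using nz by (simp add: R_def A_def B_def power_divide)
      show "y = - (R \<tau> * r \<tau>)\<^sup>2" by (simp add: y pic)
    qed (use False f in \<open>auto simp: rz\<close>)
    moreover have "- (\<i> * (r1 * p)) / (of_real pi * r \<tau>)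
        = \<i> * (dtheta2 0 0 \<tau>)\<^sup>2 * theta1_shifted \<nu> \<mu> N \<tau> * (dtheta3 0 z \<tau> * dtheta4 0 z \<tau> / (dtheta2 0 z \<tau> * (dtheta1 0 z \<tau>)\<^sup>2))"
    proof -
      have S: "dtheta1 1 z \<tau> + 2 * of_real pi * \<i> * \<alpha> * dtheta1 0 z \<tau> = theta1_shifted \<nu> \<mu> N \<tau>"
        by (simp add: theta1_shifted_eq[OF assms(1)] z \<alpha>_def)
      show ?thesis
        unfolding r1_def p_def S dtheta1_dtheta2_wronskian[OF assms(1)] rz
        using f False by (simp add: power2_eq_square divide_simps)
    qed
    ultimately show ?thesis by (simp only: sq)
  qed
qed

text \<open>
  By the Wronskian formula the solution is \<open>y = - (\<vartheta>\<^sub>4 / \<vartheta>\<^sub>3)\<^sup>2 r (s + r)\<close>. As \<open>theta1_shifted\<close> is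
  nonzero, neither \<open>r\<close> nor \<open>s\<close> vanishes, so the denominator \<open>- B r s \<theta>\<^sub>1\<^sup>2\<close> on the right is nonzero.
\<close>

lemma hitchin_y_has_derivative:
  assumes "Im \<tau> > 0" and z: "z = torsion_point \<nu> \<mu> N \<tau>" and f: "dtheta1 0 z \<tau> \<noteq> 0"
    and shifted: "theta1_shifted \<nu> \<mu> N \<tau> \<noteq> 0"
    and y: "y = hitchin_y \<nu> \<mu> N \<tau>" and x: "x = painleve_x \<tau>"
  shows "(hitchin_y \<nu> \<mu> N has_field_derivative
    of_real pi * \<i> * dtheta3 0 0 \<tau> ^ 6 * (dtheta1 0 z \<tau>)\<^sup>2
       * (y * (y - 1) * (y - x) / ((dtheta3 0 0 \<tau>)\<^sup>2 * (dtheta1 0 z \<tau>)\<^sup>2 * y + (dtheta4 0 0 \<tau>)\<^sup>2 * (dtheta2 0 z \<tau>)\<^sup>2))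
     + of_real pi / (2 * \<i>) * dtheta3 0 0 \<tau> ^ 4 * (y - x)\<^sup>2
     + of_real pi / (2 * \<i>) * dtheta2 0 0 \<tau> ^ 4 * x) (at \<tau>)"
proof -
  define \<alpha> w :: complex where "\<alpha> = of_int \<nu> / (2 * of_int N)" and "w = of_int \<mu> / (2 * of_int N)"
  define c where "c = 2 * of_real pi * \<i> * \<alpha>"
  have z': "z = \<alpha> * \<tau> + w" by (simp add: z torsion_point_def \<alpha>_def w_def)
  define R where "R = (\<lambda>t. dtheta4 0 0 t / dtheta3 0 0 t)"
  define r where "r = (\<lambda>t. dtheta2 0 (\<alpha> * t + w) t / dtheta1 0 (\<alpha> * t + w) t)"
  define s where "s = (\<lambda>t. (dtheta2 1 (\<alpha> * t + w) t * dtheta1 0 (\<alpha> * t + w) t - dtheta2 0 (\<alpha> * t + w) t * dtheta1 1 (\<alpha> * t + w) t)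
              / (dtheta1 0 (\<alpha> * t + w) t * (dtheta1 1 (\<alpha> * t + w) t + c * dtheta1 0 (\<alpha> * t + w) t)))"
  have hit: "hitchin_y \<nu> \<mu> N t = - ((R t)\<^sup>2 * (r t * (s t + r t)))" if t: "Im t > 0" for t
  proof -
    define u where "u = \<alpha> * t + w"
    have u: "torsion_point \<nu> \<mu> N t = u" by (simp add: u_def torsion_point_def \<alpha>_def w_def)
    define W where "W = dtheta2 1 u t * dtheta1 0 u t - dtheta2 0 u t * dtheta1 1 u t"
    define S where "S = dtheta1 1 u t + c * dtheta1 0 u t"
    have S: "theta1_shifted \<nu> \<mu> N t = S"
      by (simp add: theta1_shifted_eq[OF t] u S_def c_def \<alpha>_def)
    have W: "of_real pi * (dtheta2 0 0 t)\<^sup>2 * dtheta3 0 u t * dtheta4 0 u t = - W"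
      unfolding W_def dtheta1_dtheta2_wronskian[OF t] by simp
    have "hitchin_y \<nu> \<mu> N t = (dtheta4 0 0 t)\<^sup>2 / (dtheta3 0 0 t)\<^sup>2 * (dtheta2 0 u t / (dtheta1 0 u t)\<^sup>2) * (- W / S - dtheta2 0 u t)"
      unfolding hitchin_y_def Let_def vartheta2_def vartheta3_def vartheta4_def theta_eq_dtheta_0 u S W ..
    moreover have "s t = W / (dtheta1 0 u t * S)" "r t = dtheta2 0 u t / dtheta1 0 u t"
      by (simp_all add: s_def r_def W_def S_def u_def)
    ultimately show ?thesis
      by (simp add: R_def power2_eq_square divide_inverse algebra_simps)
  qed
  define A B V where "A = (dtheta3 0 0 \<tau>)\<^sup>2" and "B = (dtheta4 0 0 \<tau>)\<^sup>2" and "V = dtheta2 0 0 \<tau> ^ 4"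
  note nz = vartheta_nonzero[OF assms(1)]
  have A0: "A \<noteq> 0" and B0: "B \<noteq> 0" using nz by (simp_all add: A_def B_def)
  have sq: "A\<^sup>2 = dtheta3 0 0 \<tau> ^ 4" "B\<^sup>2 = dtheta4 0 0 \<tau> ^ 4"
    by (simp_all add: A_def B_def flip: power_mult)
  have V: "V = A\<^sup>2 - B\<^sup>2" using jacobi_quartic[OF assms(1)] by (simp add: V_def sq)
  have S: "dtheta1 1 z \<tau> + c * dtheta1 0 z \<tau> = theta1_shifted \<nu> \<mu> N \<tau>"
    by (simp add: theta1_shifted_eq[OF assms(1)] z c_def \<alpha>_def)
  have g: "dtheta2 0 z \<tau> \<noteq> 0" and g34: "dtheta3 0 z \<tau> \<noteq> 0" "dtheta4 0 z \<tau> \<noteq> 0"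
    using theta1_shifted_nonzero_imp_dtheta_nonzero[OF assms(1) z f shifted] by auto
  have rz: "r \<tau> = dtheta2 0 z \<tau> / dtheta1 0 z \<tau>" by (simp add: r_def z')
  have sz: "s \<tau> = (dtheta2 1 z \<tau> * dtheta1 0 z \<tau> - dtheta2 0 z \<tau> * dtheta1 1 z \<tau>)
              / (dtheta1 0 z \<tau> * (dtheta1 1 z \<tau> + c * dtheta1 0 z \<tau>))" by (simp add: s_def z')
  have r0: "r \<tau> \<noteq> 0" using f g by (simp add: rz)
  have s0: "s \<tau> \<noteq> 0"
    unfolding sz dtheta1_dtheta2_wronskian[OF assms(1)] S using f g34 shifted nz by simp
  define e where "e = 4 * of_real pi * \<i>"
  \<comment> \<open>\<open>\<pi>\<^sup>2 r E\<close>, \<open>\<pi>\<^sup>2 G\<close> and \<open>\<pi>\<^sup>2 Ds\<close> are \<open>r''\<close>, \<open>r'\<^sup>2\<close> and \<open>4 \<pi> i\<close> times the derivative of \<open>s\<close>\<close>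
  define E where "E = 2 * A * B * (r \<tau>)\<^sup>2 + A\<^sup>2 + B\<^sup>2"
  define G where "G = (A * (r \<tau>)\<^sup>2 + B) * (B * (r \<tau>)\<^sup>2 + A)"
  define Ds where "Ds = s \<tau> * (6 * A * B * (r \<tau>)\<^sup>2 + A\<^sup>2 + B\<^sup>2) + 2 * r \<tau> * E + 2 * A * B * r \<tau> * (s \<tau>)\<^sup>2"
  have dR: "(R has_field_derivative of_real pi ^ 2 * V * R \<tau> / e) (at \<tau>)"
  proof -
    have "of_real pi ^ 2 * V * R \<tau> / e = of_real pi / (4 * \<i>) * V * R \<tau>"
      by (simp add: e_def power2_eq_square)
    thus ?thesis
      using vartheta_quotient_derivative[OF assms(1)] unfolding R_def V_def by (simp only:)
  qed
  have dr: "(r has_field_derivative of_real pi ^ 2 * (r \<tau> * E + 2 * G / s \<tau>) / e) (at \<tau>)"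
  proof -
    define r1 where "r1 = (dtheta2 1 z \<tau> * dtheta1 0 z \<tau> - dtheta2 0 z \<tau> * dtheta1 1 z \<tau>) / (dtheta1 0 z \<tau>)\<^sup>2"
    define p where "p = (dtheta1 1 z \<tau> + 2 * of_real pi * \<i> * \<alpha> * dtheta1 0 z \<tau>) / dtheta1 0 z \<tau>"
    have "r1 = s \<tau> * p"
      using f shifted unfolding sz r1_def p_def c_def[symmetric] S by (simp add: power2_eq_square)
    moreover have "r1\<^sup>2 = of_real pi ^ 2 * G"
      using dtheta_ratio_derivatives(1)[OF assms(1) f g]
      unfolding A_def[symmetric] B_def[symmetric] rz[symmetric] r1_def[symmetric] G_def .
    ultimately have "r1 * p = of_real pi ^ 2 * G / s \<tau>" using s0 by (simp add: field_simps power2_eq_square)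
    hence "of_real pi ^ 2 * (r \<tau> * E + 2 * G / s \<tau>) = of_real pi ^ 2 * r \<tau> * E + 2 * (r1 * p)"
      by (simp add: distrib_left)
    moreover have "(r has_field_derivative (of_real pi ^ 2 * r \<tau> * E + 2 * r1 * p) / e) (at \<tau>)"
      using dtheta_ratio_has_derivative[OF assms(1) z' f g]
      unfolding r_def[symmetric] rz[symmetric] A_def[symmetric] B_def[symmetric] r1_def[symmetric] p_def[symmetric]
        e_def[symmetric] E_def .
    ultimately show ?thesis by (simp only: mult.assoc)
  qed
  have ds: "(s has_field_derivative of_real pi ^ 2 * Ds / e) (at \<tau>)"
    using slope_has_derivative[OF assms(1) z' c_def f g shifted[folded S]]
    unfolding s_def[symmetric] rz[symmetric] sz[symmetric] A_def[symmetric] B_def[symmetric] e_def[symmetric]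
      Ds_def E_def .
  define H where "H = 2 * (of_real pi ^ 2 * V * R \<tau> / e) * R \<tau> * (r \<tau> * (s \<tau> + r \<tau>))
      + (R \<tau>)\<^sup>2 * (of_real pi ^ 2 * (r \<tau> * E + 2 * G / s \<tau>) / e * (s \<tau> + r \<tau>)
        + r \<tau> * (of_real pi ^ 2 * Ds / e + of_real pi ^ 2 * (r \<tau> * E + 2 * G / s \<tau>) / e))"
  have "((\<lambda>t. - ((R t)\<^sup>2 * (r t * (s t + r t)))) has_field_derivative - H) (at \<tau>)"
    unfolding H_def by (rule derivative_eq_intros dR dr ds refl | simp add: algebra_simps power2_eq_square)+
  hence dH: "(hitchin_y \<nu> \<mu> N has_field_derivative - H) (at \<tau>)"
    by (rule has_field_derivative_transform_within_open[where S = "{t. Im t > 0}"])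
       (use assms(1) hit in \<open>auto intro: open_halfspace_Im_gt\<close>)
  have R2: "(R \<tau>)\<^sup>2 = B / A" by (simp add: R_def A_def B_def power_divide)
  have y': "y = - (B / A) * (r \<tau> * (s \<tau> + r \<tau>))" by (simp add: y hit[OF assms(1)] R2)
  have x': "x = B\<^sup>2 / A\<^sup>2"
    by (simp add: x painleve_x_def vartheta3_def vartheta4_def theta_eq_dtheta_0 sq)
  have "- H = of_real pi ^ 2 / e * (2 * (A\<^sup>2 - B\<^sup>2) * y
      - B / A * ((r \<tau> * E + 2 * G / s \<tau>) * (s \<tau> + 2 * r \<tau>) + r \<tau> * Ds))"
    unfolding H_def V R2[symmetric] y' by (simp add: algebra_simps power2_eq_square add_divide_distrib diff_divide_distrib)
  also have "2 * (A\<^sup>2 - B\<^sup>2) * y - B / A * ((r \<tau> * E + 2 * G / s \<tau>) * (s \<tau> + 2 * r \<tau>) + r \<tau> * Ds)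
     = - 4 * A ^ 3 * (y * (y - 1) * (y - x) / (A * y + B * (r \<tau>)\<^sup>2)) + 2 * A\<^sup>2 * (y - x)\<^sup>2 + 2 * (A\<^sup>2 - B\<^sup>2) * x"
    unfolding Ds_def E_def G_def by (rule hitchin_vector_field_algebra[OF A0 B0 r0 s0 y' x', folded add.assoc])
  also have "of_real pi ^ 2 / e = of_real pi / (4 * \<i>)" by (simp add: e_def power2_eq_square)
  also have "of_real pi / (4 * \<i>) * (- 4 * A ^ 3 * (y * (y - 1) * (y - x) / (A * y + B * (r \<tau>)\<^sup>2)) + 2 * A\<^sup>2 * (y - x)\<^sup>2 + 2 * (A\<^sup>2 - B\<^sup>2) * x)
     = of_real pi * \<i> * (A ^ 3 * (y * (y - 1) * (y - x) / (A * y + B * (r \<tau>)\<^sup>2)))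
       + of_real pi / (2 * \<i>) * A\<^sup>2 * (y - x)\<^sup>2 + of_real pi / (2 * \<i>) * (A\<^sup>2 - B\<^sup>2) * x"
  proof -
    have "of_real pi / (4 * \<i>) = - \<i> * of_real pi / 4" "of_real pi / (2 * \<i>) = - \<i> * of_real pi / 2"
      by (simp_all add: field_simps)
    thus ?thesis by algebra
  qed
  also have "A ^ 3 * (y * (y - 1) * (y - x) / (A * y + B * (r \<tau>)\<^sup>2))
     = dtheta3 0 0 \<tau> ^ 6 * (dtheta1 0 z \<tau>)\<^sup>2 * (y * (y - 1) * (y - x) / (A * (dtheta1 0 z \<tau>)\<^sup>2 * y + B * (dtheta2 0 z \<tau>)\<^sup>2))"
  proof -
    have "A * (dtheta1 0 z \<tau>)\<^sup>2 * y + B * (dtheta2 0 z \<tau>)\<^sup>2 = (dtheta1 0 z \<tau>)\<^sup>2 * (A * y + B * (r \<tau>)\<^sup>2)"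
      using f by (simp add: rz power_divide distrib_left)
    moreover have "A ^ 3 = dtheta3 0 0 \<tau> ^ 6" by (simp add: A_def flip: power_mult)
    ultimately show ?thesis using f by simp
  qed
  finally have H: "- H = of_real pi * \<i> * (dtheta3 0 0 \<tau> ^ 6 * (dtheta1 0 z \<tau>)\<^sup>2
        * (y * (y - 1) * (y - x) / (A * (dtheta1 0 z \<tau>)\<^sup>2 * y + B * (dtheta2 0 z \<tau>)\<^sup>2)))
      + of_real pi / (2 * \<i>) * dtheta3 0 0 \<tau> ^ 4 * (y - x)\<^sup>2
      + of_real pi / (2 * \<i>) * dtheta2 0 0 \<tau> ^ 4 * x"
    unfolding V[symmetric] unfolding V_def sq(1) .
  show ?thesis using dH unfolding H A_def B_def mult.assoc .
qed

theorem theorem9: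
  fixes \<nu> \<mu> N :: int and \<tau> :: complex
  assumes "N \<noteq> 0" and "Im \<tau> > 0"
    and "theta1 (torsion_point \<nu> \<mu> N \<tau>) \<tau> \<noteq> 0"
  shows
    "let z = torsion_point \<nu> \<mu> N \<tau>;
         t1 = theta1 z \<tau>; t2 = theta2 z \<tau>; t3 = theta3 z \<tau>; t4 = theta4 z \<tau>;
         v2 = vartheta2 \<tau>; v3 = vartheta3 \<tau>; v4 = vartheta4 \<tau>;
         x = painleve_x \<tau>
     in (theta1_shifted \<nu> \<mu> N \<tau> \<noteq> 0 \<longrightarrow>
          (let y = hitchin_y \<nu> \<mu> N \<tau>
           in (hitchin_y \<nu> \<mu> N has_field_derivative
                (of_real pi * \<i> * v3 ^ 6 * t1\<^sup>2
                   * (y * (y - 1) * (y - x) / (v3\<^sup>2 * t1\<^sup>2 * y + v4\<^sup>2 * t2\<^sup>2))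
                 + of_real pi / (2 * \<i>) * v3 ^ 4 * (y - x)\<^sup>2
                 + of_real pi / (2 * \<i>) * v2 ^ 4 * x)) (at \<tau>)))
        \<and> (let y = picard_y \<nu> \<mu> N \<tau>
           in (picard_y \<nu> \<mu> N has_field_derivative
                (\<i> * v2\<^sup>2 * theta1_shifted \<nu> \<mu> N \<tau> * (t3 * t4 / (t2 * t1\<^sup>2)) * y
                 + of_real pi * \<i> * v3 ^ 4 * y * (y - 1))) (at \<tau>))"
proof -
  have f: "dtheta1 0 (torsion_point \<nu> \<mu> N \<tau>) \<tau> \<noteq> 0" using assms(3) by (simp add: theta_eq_dtheta_0)
  show ?thesis
    unfolding Let_def vartheta2_def vartheta3_def vartheta4_def theta_eq_dtheta_0
    using hitchin_y_has_derivative[OF assms(2) refl f _ refl refl]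
      picard_y_has_derivative[OF assms(2) refl f refl]
    by blast
qed

end
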